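(* Let $X_1,\dots,X_n$ be zero-mean jointly Gaussian real random variables, and let $a_1\in(0,\infty]$ (where $|X_1|\le\infty$ is the sure event). Then \[ \Pr(|X_1|\le 1+a_1)\,\Pr(|X_i|\le 1\ \forall i\in[n]) \;\ge\; \Pr(|X_1|\le 1)\,\Pr(|X_1|\le 1+a_1,\ |X_2|\le 1,\dots,|X_n|\le 1). \] Consequently, \[ \frac{\Pr(|X_i|\le 1\ \forall i\in[n])}{\prod_{i=1}^n\Pr(|X_i|\le 1)} \;\ge\; \sup_{a_1,\dots,a_n\in(0,\infty)} \frac{\Pr(|X_i|\le 1+a_i\ \forall i\in[n])}{\prod_{i=1}^n \Pr(|X_i|\le 1+a_i)}. \]
   Context: $[n]=\{1,\dots,n\}$. Zero-mean jointly Gaussian means $(X_1,\dots,X_n)$ is a centered Gaussian vector (possibly degenerate). *)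

theory Defs
  imports "HOL-Probability.Probability"
begin

definition centered_gaussian_rv :: "'a measure \<Rightarrow> ('a \<Rightarrow> real) \<Rightarrow> bool" where
  "centered_gaussian_rv M Y \<longleftrightarrow>
     Y \<in> borel_measurable M \<and>
     ((AE \<omega> in M. Y \<omega> = 0) \<or> (\<exists>\<sigma>>0. distributed M lborel Y (normal_density 0 \<sigma>)))"

definition centered_jointly_gaussian :: "'a measure \<Rightarrow> nat \<Rightarrow> (nat \<Rightarrow> 'a \<Rightarrow> real) \<Rightarrow> bool" where
  "centered_jointly_gaussian M n X \<longleftrightarrow>
     (\<forall>i\<in>{1..n}. X i \<in> borel_measurable M) \<and>
     (\<forall>c :: nat \<Rightarrow> real. centered_gaussian_rv M (\<lambda>\<omega>. \<Sum>i\<in>{1..n}. c i * X i \<omega>))"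

end

(* Write X_i = c_i X_1 + Y_i with Y = (Y_2, ..., Y_n) independent of X_1. Then
   Pr(|X_i| <= 1 for i >= 2 | X_1 = s) = g(s) := Pr(|Y_i + c_i s| <= 1 for i >= 2).
   By symmetry g is even, and u |-> Pr(|Y_i + u_i| <= r_i for all i) is log-concave: split off one coordinate
   at a time and apply the one-dimensional Prekopa-Leindler inequality, in which all superlevel sets are
   intervals. Hence g decreases in |s|, and so does its average over [-t, t] as a function of t, which is the
   first claim. Shrinking the n thresholds one after another yields the second. *)

theory Submission
  imports Defs
begin

subsection \<open>The Prekopa-Leindler inequality on the line\<close>

text \<open>Joint Gaussianity is given only through linear combinations, and the vector may be
  degenerate, so neither a joint density nor an independence statement is available at the start.
  Characteristic functions replace both. The transform of a centered Gaussian combination is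
  determined by its second moment, so removing the correlation with one coordinate
  \<open>X k\<close> already makes the joint characteristic function factor. Uniqueness then writes
  box probabilities as integrals over the value of \<open>X k\<close>, and this is the form in which
  independence is used.

  Each coordinate that is split off is either almost surely zero or has a normal density, so
  degeneracy becomes a case distinction in one dimension. Fixing \<open>X k = s\<close> moves the
  other intervals by \<open>c i * s\<close>; hence log-concavity has to be proved for all shifts at
  once. Because the integrands are themselves log-concave, the Brunn-Minkowski inequality behind
  Prekopa-Leindler reduces to adding lengths of intervals.\<close>

lemma nn_integral_layer_cake:
  fixes f :: "real \<Rightarrow> real"
  assumes [measurable]: "f \<in> borel_measurable borel"
  shows "(\<integral>\<^sup>+x. ennreal (f x) \<partial>lborel) = (\<integral>\<^sup>+t. indicator {0<..} t * emeasure lborel {x. t < f x} \<partial>lborel)"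
proof -
  have "(\<integral>\<^sup>+x. ennreal (f x) \<partial>lborel) = (\<integral>\<^sup>+x. (\<integral>\<^sup>+t. indicator {(x, t). 0 < t \<and> t < f x} (x, t) \<partial>lborel) \<partial>lborel)"
  proof (rule nn_integral_cong)
    fix x :: real
    have "(\<integral>\<^sup>+t. indicator {(x, t). 0 < t \<and> t < f x} (x, t) \<partial>lborel) = (\<integral>\<^sup>+t. indicator {0<..<f x} t \<partial>lborel)"
      by (intro nn_integral_cong) (auto split: split_indicator)
    also have "\<dots> = ennreal (f x)"
      by (cases "0 \<le> f x") (auto simp: ennreal_neg)
    finally show "ennreal (f x) = (\<integral>\<^sup>+t. indicator {(x, t). 0 < t \<and> t < f x} (x, t) \<partial>lborel)"
      by simp
  qed
  also have "\<dots> = (\<integral>\<^sup>+t. (\<integral>\<^sup>+x. indicator {(x, t). 0 < t \<and> t < f x} (x, t) \<partial>lborel) \<partial>lborel)"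
    by (rule lborel_pair.Fubini') measurable
  also have "\<dots> = (\<integral>\<^sup>+t. indicator {0<..} t * emeasure lborel {x. t < f x} \<partial>lborel)"
  proof (rule nn_integral_cong)
    fix t :: real
    have "(\<integral>\<^sup>+x. indicator {(x, t). 0 < t \<and> t < f x} (x, t) \<partial>lborel)
       = (\<integral>\<^sup>+x. indicator {0<..} t * indicator {x. t < f x} x \<partial>lborel)"
      by (intro nn_integral_cong) (auto split: split_indicator)
    also have "\<dots> = indicator {0<..} t * emeasure lborel {x. t < f x}"
      by (subst nn_integral_cmult) auto
    finally show "(\<integral>\<^sup>+x. indicator {(x, t). 0 < t \<and> t < f x} (x, t) \<partial>lborel) = \<dots>" .
  qed
  finally show ?thesis .
qed

text \<open>Brunn-Minkowski on the line. For intervals the combined set contains the open interval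
  between the two combinations of endpoints, and its length is the same combination of the lengths.
  Taking any Borel \<open>C\<close> that contains the combined set avoids asking whether that set is
  measurable.\<close>

lemma emeasure_interval_combination_le:
  fixes A B C :: "real set"
  assumes l: "0 < l" "l < 1"
    and AB: "is_interval A" "is_interval B" "bounded A" "bounded B" "A \<noteq> {}" "B \<noteq> {}"
    and C: "C \<in> sets borel" "\<And>x y. x \<in> A \<Longrightarrow> y \<in> B \<Longrightarrow> l * x + (1 - l) * y \<in> C"
  shows "ennreal l * emeasure lborel A + ennreal (1 - l) * emeasure lborel B \<le> emeasure lborel C"
proof -
  have bd: "bdd_above A" "bdd_below A" "bdd_above B" "bdd_below B"
    using AB by (auto intro: bounded_imp_bdd_above bounded_imp_bdd_below)
  have le: "Inf A \<le> Sup A" "Inf B \<le> Sup B"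
    using bd AB by (auto intro: cInf_le_cSup)
  have in_int: "x \<in> S" if S: "is_interval S" "bdd_above S" "bdd_below S" "S \<noteq> {}" "Inf S < x" "x < Sup S" for S and x :: real
  proof -
    obtain p where "p \<in> S" "p < x" using cInf_lessD[OF S(4,5)] by blast
    moreover obtain q where "q \<in> S" "x < q" using less_cSupD[OF S(4,6)] by blast
    ultimately show ?thesis using \<open>is_interval S\<close> unfolding is_interval_1 by (meson less_imp_le)
  qed
  have em: "emeasure lborel S \<le> ennreal (Sup S - Inf S)" if "bdd_above S" "bdd_below S" "S \<noteq> {}" for S :: "real set"
  proof -
    have "S \<subseteq> {Inf S..Sup S}" using that by (auto intro: cInf_lower cSup_upper)
    hence "emeasure lborel S \<le> emeasure lborel {Inf S..Sup S}" by (intro emeasure_mono) auto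
    also have "\<dots> = ennreal (Sup S - Inf S)" using that by (subst emeasure_lborel_Icc) (auto intro: cInf_le_cSup)
    finally show ?thesis .
  qed
  let ?p = "l * Inf A + (1 - l) * Inf B" and ?q = "l * Sup A + (1 - l) * Sup B"
  have comb: "x \<in> C" if x: "?p < x" "x < ?q" for x
  proof -
    \<comment> \<open>The same relative position in \<open>A\<close> and \<open>B\<close> as that of \<open>x\<close> between \<open>?p\<close> and \<open>?q\<close>.\<close>
    define \<theta> where "\<theta> = (x - ?p) / (?q - ?p)"
    have th: "0 < \<theta>" "\<theta> < 1" using x unfolding \<theta>_def by (auto simp: divide_simps)
    have xe: "x = ?p + \<theta> * (?q - ?p)" using x unfolding \<theta>_def by (auto simp: divide_simps)
    define a where "a = Inf A + \<theta> * (Sup A - Inf A)"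
    define b where "b = Inf B + \<theta> * (Sup B - Inf B)"
    have mem: "Inf S + \<theta> * (Sup S - Inf S) \<in> S" if S: "is_interval S" "bounded S" "S \<noteq> {}" for S :: "real set"
    proof -
      have bS: "bdd_above S" "bdd_below S" using S by (auto intro: bounded_imp_bdd_above bounded_imp_bdd_below)
      have leS: "Inf S \<le> Sup S" using bS S by (auto intro: cInf_le_cSup)
      show ?thesis
      \<comment> \<open>\<open>in_int\<close> reaches only points strictly between the endpoints,
        and a one-point interval has none; there the requested point is its only element.\<close>
      proof (cases "Inf S = Sup S")
        case True
        obtain s where s: "s \<in> S" using S by auto
        have "Inf S \<le> s" "s \<le> Sup S" using s bS by (auto intro: cInf_lower cSup_upper)
        thus ?thesis using True s by auto
      next
        case False
        hence lt: "0 < Sup S - Inf S" using leS by auto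
        have "0 < \<theta> * (Sup S - Inf S)" "\<theta> * (Sup S - Inf S) < 1 * (Sup S - Inf S)"
          using th lt by (auto intro: mult_strict_right_mono)
        thus ?thesis by (intro in_int) (use S bS in auto)
      qed
    qed
    have "l * a + (1 - l) * b \<in> C" unfolding a_def b_def by (intro C mem AB)
    also have "l * a + (1 - l) * b = x" unfolding a_def b_def xe by (simp add: algebra_simps)
    finally show ?thesis .
  qed
  have pq: "?p \<le> ?q" using le l by (intro add_mono mult_left_mono) auto
  have "ennreal l * emeasure lborel A + ennreal (1 - l) * emeasure lborel B
     \<le> ennreal l * ennreal (Sup A - Inf A) + ennreal (1 - l) * ennreal (Sup B - Inf B)"
    using bd AB by (intro add_mono mult_left_mono em) auto
  also have "\<dots> = ennreal (?q - ?p)"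
  proof -
    have "?q - ?p = l * (Sup A - Inf A) + (1 - l) * (Sup B - Inf B)" by (simp add: algebra_simps)
    thus ?thesis using l le by (simp add: ennreal_mult ennreal_plus)
  qed
  also have "\<dots> = emeasure lborel {?p<..<?q}" using pq by (subst emeasure_lborel_Ioo) auto
  also have "\<dots> \<le> emeasure lborel C" using C comb by (intro emeasure_mono) auto
  finally show ?thesis .
qed

text \<open>The interval bound needs both superlevel sets nonempty. With both suprema equal to 1
  they become empty at the same height: both are nonempty for 0 < t < 1 and both empty from
  \<open>t = 1\<close> on. Integrating over the heights gives a bound by the arithmetic
  mean.\<close>

lemma prekopa_leindler_sup_one:
  fixes f g h :: "real \<Rightarrow> real"
  assumes l: "0 < l" "l < 1"
    and [measurable]: "f \<in> borel_measurable borel" "g \<in> borel_measurable borel" "h \<in> borel_measurable borel"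
    and f: "\<And>x. 0 \<le> f x" "\<And>x. f x \<le> 1" "\<And>t. t < 1 \<Longrightarrow> \<exists>x. t < f x"
    and g: "\<And>x. 0 \<le> g x" "\<And>x. g x \<le> 1" "\<And>t. t < 1 \<Longrightarrow> \<exists>x. t < g x"
    and int: "\<And>t. 0 < t \<Longrightarrow> is_interval {x. t < f x}" "\<And>t. 0 < t \<Longrightarrow> is_interval {x. t < g x}"
    and bd: "\<And>t. 0 < t \<Longrightarrow> bounded {x. t < f x}" "\<And>t. 0 < t \<Longrightarrow> bounded {x. t < g x}"
    and h: "\<And>x y. f x powr l * g y powr (1 - l) \<le> h (l * x + (1 - l) * y)"
  shows "ennreal l * (\<integral>\<^sup>+x. f x \<partial>lborel) + ennreal (1 - l) * (\<integral>\<^sup>+x. g x \<partial>lborel) \<le> (\<integral>\<^sup>+x. h x \<partial>lborel)"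
proof -
  have sup: "t < f x powr l * g y powr (1 - l)" if "0 < t" "t < f x" "t < g y" for t x y
  proof -
    have "t = t powr l * t powr (1 - l)" using that by (simp add: powr_add[symmetric])
    also have "\<dots> < f x powr l * g y powr (1 - l)"
      using that l by (intro mult_strict_mono powr_less_mono2) auto
    finally show ?thesis .
  qed
  have level: "ennreal l * (indicator {0<..} t * emeasure lborel {x. t < f x})
       + ennreal (1 - l) * (indicator {0<..} t * emeasure lborel {x. t < g x})
     \<le> indicator {0<..} t * emeasure lborel {x. t < h x}" for t
  proof (cases "0 < t \<and> t < 1")
    case True
    have "l * x + (1 - l) * y \<in> {x. t < h x}" if "x \<in> {x. t < f x}" "y \<in> {x. t < g x}" for x y
      using True that sup[of t x y] h[of x y] by auto
    hence "ennreal l * emeasure lborel {x. t < f x} + ennreal (1 - l) * emeasure lborel {x. t < g x}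
      \<le> emeasure lborel {x. t < h x}"
      using True f(3)[of t] g(3)[of t]
      by (intro emeasure_interval_combination_le l int bd) auto
    thus ?thesis using True by (simp add: indicator_def)
  next
    case False
    have "{x. t < f x} = {}" "{x. t < g x} = {}" if "0 < t"
      using False that f(2) g(2) by (auto simp: not_less intro: order_trans)
    thus ?thesis using False by (auto simp: indicator_def)
  qed
  have m: "(\<lambda>t. emeasure lborel {x. t < u x}) \<in> borel_measurable lborel"
    if [measurable]: "u \<in> borel_measurable borel" for u :: "real \<Rightarrow> real"
    by measurable
  have [measurable]: "(\<lambda>t. indicator {0<..} t * emeasure lborel {x. t < u x}) \<in> borel_measurable lborel"
    if "u \<in> borel_measurable borel" for u :: "real \<Rightarrow> real"
    using m[OF that] by measurable
  show ?thesis
    unfolding nn_integral_layer_cake[OF assms(3)] nn_integral_layer_cake[OF assms(4)] nn_integral_layer_cake[OF assms(5)]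
    apply (subst (1 2) nn_integral_cmult[symmetric])
      apply measurable
    apply (subst nn_integral_add[symmetric])
      apply measurable
    apply (intro nn_integral_mono level)
    done
qed

text \<open>Dividing \<open>f\<close> and \<open>g\<close> by their suprema \<open>F\<close> and
  \<open>G\<close>, and \<open>h\<close> by \<open>F powr l * G powr (1 - l)\<close>, preserves the
  hypothesis and makes both suprema 1. The weighted AM-GM inequality then turns the additive bound
  into the multiplicative one, and the scaling cancels.\<close>

lemma prekopa_leindler_interval:
  fixes f g h :: "real \<Rightarrow> real"
  assumes l: "0 < l" "l < 1"
    and [measurable]: "f \<in> borel_measurable borel" "g \<in> borel_measurable borel"
    and ih: "integrable lborel h"
    and f: "\<And>x. 0 \<le> f x" "\<And>x. f x \<le> K" and g: "\<And>x. 0 \<le> g x" "\<And>x. g x \<le> K"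
    and h0: "\<And>x. 0 \<le> h x"
    and int: "\<And>t. 0 < t \<Longrightarrow> is_interval {x. t < f x}" "\<And>t. 0 < t \<Longrightarrow> is_interval {x. t < g x}"
    and bd: "bounded {x. f x \<noteq> 0}" "bounded {x. g x \<noteq> 0}"
    and h: "\<And>x y. f x powr l * g y powr (1 - l) \<le> h (l * x + (1 - l) * y)"
  shows "(\<integral>x. f x \<partial>lborel) powr l * (\<integral>x. g x \<partial>lborel) powr (1 - l) \<le> (\<integral>x. h x \<partial>lborel)"
\<comment> \<open>A vanishing integral makes the left side 0, as \<open>0 powr a = 0\<close>.
  Otherwise \<open>f\<close> and \<open>g\<close> are integrable, because the Bochner integral of a
  nonintegrable function is 0 by convention.\<close>
proof (cases "(\<integral>x. f x \<partial>lborel) = 0 \<or> (\<integral>x. g x \<partial>lborel) = 0")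
  case True
  thus ?thesis using h0 by (auto intro!: integral_nonneg_AE)
next
  case False
  have [measurable]: "h \<in> borel_measurable borel" using ih by auto
  have intf: "integrable lborel f" "integrable lborel g"
    using False not_integrable_integral_eq by blast+
  define F where "F = (SUP x. f x)"
  define G where "G = (SUP x. g x)"
  have bdd: "bdd_above (range f)" "bdd_above (range g)" using f g by (auto intro!: bdd_aboveI)
  have fF: "f x \<le> F" "g x \<le> G" for x unfolding F_def G_def by (auto intro!: cSUP_upper bdd)
  obtain x0 where x0: "f x0 \<noteq> 0"
  proof (atomize_elim, rule ccontr)
    assume "\<nexists>x. f x \<noteq> 0"
    hence "f = (\<lambda>_. 0)" by auto
    thus False using False by simp
  qed
  obtain y0 where y0: "g y0 \<noteq> 0"
  proof (atomize_elim, rule ccontr)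
    assume "\<nexists>x. g x \<noteq> 0"
    hence "g = (\<lambda>_. 0)" by auto
    thus False using False by simp
  qed
  have "0 < f x0" "0 < g y0" using x0 y0 f(1)[of x0] g(1)[of y0] by auto
  hence F0: "0 < F" and G0: "0 < G" using fF(1)[of x0] fF(2)[of y0] by auto
  define H where "H = F powr l * G powr (1 - l)"
  have H0: "0 < H" unfolding H_def using F0 G0 by auto
  have exf: "\<exists>x. t < f x / F" if "t < 1" for t
  proof -
    have "t * F < F" using that F0 by simp
    then obtain x where "t * F < f x" unfolding F_def using bdd by (subst (asm) less_cSUP_iff) auto
    thus ?thesis using F0 by (auto simp: field_simps)
  qed
  have exg: "\<exists>x. t < g x / G" if "t < 1" for t
  proof -
    have "t * G < G" using that G0 by simp
    then obtain x where "t * G < g x" unfolding G_def using bdd by (subst (asm) less_cSUP_iff) auto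
    thus ?thesis using G0 by (auto simp: field_simps)
  qed
  have lev: "{x. t < f x / F} = {x. t * F < f x}" "{x. t < g x / G} = {x. t * G < g x}" for t
    using F0 G0 by (auto simp: field_simps)
  have bdl: "bounded {x. t * F < f x}" "bounded {x. t * G < g x}" if "0 < t" for t
  proof -
    have "0 < t * F" "0 < t * G" using that F0 G0 by auto
    thus "bounded {x. t * F < f x}" "bounded {x. t * G < g x}"
      by (auto intro: bounded_subset[OF bd(1)] bounded_subset[OF bd(2)])
  qed
  have "ennreal l * (\<integral>\<^sup>+x. f x / F \<partial>lborel) + ennreal (1 - l) * (\<integral>\<^sup>+x. g x / G \<partial>lborel) \<le> (\<integral>\<^sup>+x. h x / H \<partial>lborel)"
  proof (rule prekopa_leindler_sup_one[OF l])
    fix x y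
    have "(f x / F) powr l * (g y / G) powr (1 - l) = (f x powr l * g y powr (1 - l)) / H"
      unfolding H_def using F0 G0 f g by (simp add: powr_divide)
    also have "\<dots> \<le> h (l * x + (1 - l) * y) / H" using H0 by (intro divide_right_mono h) auto
    finally show "(f x / F) powr l * (g y / G) powr (1 - l) \<le> h (l * x + (1 - l) * y) / H" .
  qed (use f g F0 G0 fF exf exg int bdl in \<open>auto simp: lev\<close>)
  also have "(\<integral>\<^sup>+x. f x / F \<partial>lborel) = ennreal ((\<integral>x. f x \<partial>lborel) / F)"
    using intf f F0 by (subst nn_integral_eq_integral) auto
  also have "(\<integral>\<^sup>+x. g x / G \<partial>lborel) = ennreal ((\<integral>x. g x \<partial>lborel) / G)"
    using intf g G0 by (subst nn_integral_eq_integral) auto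
  also have "(\<integral>\<^sup>+x. h x / H \<partial>lborel) = ennreal ((\<integral>x. h x \<partial>lborel) / H)"
    using ih h0 H0 by (subst nn_integral_eq_integral) auto
  finally have "ennreal (l * ((\<integral>x. f x \<partial>lborel) / F) + (1 - l) * ((\<integral>x. g x \<partial>lborel) / G)) \<le> ennreal ((\<integral>x. h x \<partial>lborel) / H)"
    using l F0 G0 f g by (simp add: ennreal_mult[symmetric] ennreal_plus[symmetric] del: ennreal_plus)
  hence *: "l * ((\<integral>x. f x \<partial>lborel) / F) + (1 - l) * ((\<integral>x. g x \<partial>lborel) / G) \<le> (\<integral>x. h x \<partial>lborel) / H"
    using H0 h0 by (subst (asm) ennreal_le_iff) auto
  have "((\<integral>x. f x \<partial>lborel) / F) powr l * ((\<integral>x. g x \<partial>lborel) / G) powr (1 - l) \<le> (\<integral>x. h x \<partial>lborel) / H"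
  proof (rule order_trans[OF Youngs_inequality_0 *])
    show "0 < (\<integral>x. f x \<partial>lborel) / F" "0 < (\<integral>x. g x \<partial>lborel) / G"
      using False F0 G0 f g by (auto simp: order_less_le intro!: integral_nonneg_AE)
  qed (use l in auto)
  also have "((\<integral>x. f x \<partial>lborel) / F) powr l * ((\<integral>x. g x \<partial>lborel) / G) powr (1 - l) =
     ((\<integral>x. f x \<partial>lborel) powr l * (\<integral>x. g x \<partial>lborel) powr (1 - l)) / H"
    unfolding H_def using F0 G0 f g by (simp add: powr_divide)
  finally show ?thesis using H0 by (simp add: divide_le_cancel)
qed

subsection \<open>Uniqueness of joint characteristic functions\<close>

lemma integrable_scaleR_iexp:
  fixes w f :: "'a \<Rightarrow> real"
  assumes "integrable M w" "f \<in> borel_measurable M"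
  shows "complex_integrable M (\<lambda>x. w x *\<^sub>R iexp (f x))"
  using assms by (intro Bochner_Integration.integrable_bound[OF assms(1)]) auto

text \<open>Levy's uniqueness theorem concerns probability measures. At \<open>s = 0\<close> the
  hypothesis gives both weights the same total mass \<open>c\<close>; divided by \<open>c\<close>
  they are densities, and the laws of \<open>Y\<close> and \<open>Z\<close> under them have equal
  characteristic functions. If \<open>c = 0\<close>, both weights vanish almost everywhere.\<close>

lemma weighted_char_unique:
  fixes w Y :: "'a \<Rightarrow> real" and v Z :: "'b \<Rightarrow> real"
  assumes w: "integrable M w" "\<And>x. 0 \<le> w x" and v: "integrable N v" "\<And>x. 0 \<le> v x"
    and Y[measurable]: "Y \<in> borel_measurable M" and Z[measurable]: "Z \<in> borel_measurable N"
    and char: "\<And>s. (CLINT x|M. w x *\<^sub>R iexp (s * Y x)) = (CLINT x|N. v x *\<^sub>R iexp (s * Z x))"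
    and B[measurable]: "B \<in> sets borel"
  shows "(\<integral>x. w x * indicator B (Y x) \<partial>M) = (\<integral>x. v x * indicator B (Z x) \<partial>N)"
proof -
  have [measurable]: "w \<in> borel_measurable M" "v \<in> borel_measurable N" using w v by auto
  define c where "c = (\<integral>x. w x \<partial>M)"
  have "complex_of_real c = complex_of_real (\<integral>x. v x \<partial>N)"
    using char[of 0] unfolding c_def by (simp add: scaleR_conv_of_real)
  hence cv: "c = (\<integral>x. v x \<partial>N)" by (simp only: of_real_eq_iff)
  have c0: "0 \<le> c" unfolding c_def using w by (intro integral_nonneg_AE) auto
  show ?thesis
  proof (cases "c = 0")
    case True
    have "AE x in M. w x = 0" using True w unfolding c_def by (subst (asm) integral_nonneg_eq_0_iff_AE) auto
    hence "(\<integral>x. w x * indicator B (Y x) \<partial>M) = 0" by (intro integral_eq_zero_AE) auto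
    moreover have "AE x in N. v x = 0" using True v unfolding cv by (subst (asm) integral_nonneg_eq_0_iff_AE) auto
    hence "(\<integral>x. v x * indicator B (Z x) \<partial>N) = 0" by (intro integral_eq_zero_AE) auto
    ultimately show ?thesis by simp
  next
    case False
    hence cpos: "0 < c" using c0 by simp
    have gen: "real_distribution (distr (density K (\<lambda>x. u x / c)) borel U)
       \<and> char (distr (density K (\<lambda>x. u x / c)) borel U) = (\<lambda>s. (CLINT x|K. u x *\<^sub>R iexp (s * U x)) / c)
       \<and> measure (distr (density K (\<lambda>x. u x / c)) borel U) B = (\<integral>x. u x * indicator B (U x) \<partial>K) / c"
      if u: "integrable K u" "\<And>x. 0 \<le> u x" and [measurable]: "U \<in> borel_measurable K" and uc: "(\<integral>x. u x \<partial>K) = c"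
      for K :: "'c measure" and u U :: "'c \<Rightarrow> real"
    proof -
      have [measurable]: "u \<in> borel_measurable K" using u by auto
      have "(\<integral>\<^sup>+x. ennreal (u x / c) \<partial>K) = ennreal ((\<integral>x. u x / c \<partial>K))"
        using u cpos by (intro nn_integral_eq_integral) auto
      also have "\<dots> = 1" using uc cpos by simp
      finally have P: "prob_space (density K (\<lambda>x. u x / c))"
        by (intro prob_spaceI) (simp add: emeasure_density cong: nn_integral_cong)
      interpret P: prob_space "density K (\<lambda>x. u x / c)" by (rule P)
      have U: "U \<in> borel_measurable (density K (\<lambda>x. u x / c))" by simp
      have 1: "real_distribution (distr (density K (\<lambda>x. u x / c)) borel U)"
        using U by (rule P.real_distribution_distr)
      have 2: "char (distr (density K (\<lambda>x. u x / c)) borel U) s = (CLINT x|K. u x *\<^sub>R iexp (s * U x)) / c" for s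
      proof -
        have "char (distr (density K (\<lambda>x. u x / c)) borel U) s = (CLINT x|density K (\<lambda>x. u x / c). iexp (s * U x))"
          unfolding char_def by (subst integral_distr[OF U]) auto
        also have "\<dots> = (CLINT x|K. (u x / c) *\<^sub>R iexp (s * U x))"
          using u cpos by (subst integral_density) auto
        also have "\<dots> = (CLINT x|K. (u x *\<^sub>R iexp (s * U x)) / c)"
          by (intro Bochner_Integration.integral_cong) (auto simp: scaleR_conv_of_real)
        finally show ?thesis by simp
      qed
      have "measure (distr (density K (\<lambda>x. u x / c)) borel U) B = (\<integral>x. indicator B x \<partial>distr (density K (\<lambda>x. u x / c)) borel U)"
        by simp
      also have "\<dots> = (\<integral>x. indicator B (U x) \<partial>density K (\<lambda>x. u x / c))"
        by (subst integral_distr[OF U]) auto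
      also have "\<dots> = (\<integral>x. (u x / c) * indicator B (U x) \<partial>K)"
        using u cpos by (subst integral_density) auto
      also have "\<dots> = (\<integral>x. u x * indicator B (U x) \<partial>K) / c"
        by simp
      finally show ?thesis using 1 2 by auto
    qed
    note gM = gen[OF w Y c_def[symmetric]] and gN = gen[OF v Z cv[symmetric]]
    have "distr (density M (\<lambda>x. w x / c)) borel Y = distr (density N (\<lambda>x. v x / c)) borel Z"
      using gM gN char by (intro Levy_uniqueness) auto
    thus ?thesis using gM gN cpos by (metis divide_cancel_right less_irrefl)
  qed
qed

text \<open>Induction on the index set: the indicator of one coordinate is absorbed into the weight. That this
  preserves equality of the joint characteristic functions is the one-dimensional uniqueness theorem
  for the nonnegative weights \<open>w (1 + cos (\<phi> + \<theta>))\<close>, with \<open>\<phi>\<close> linear in the remaining coordinates.\<close>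

lemma joint_char_unique:
  fixes w :: "'a \<Rightarrow> real" and v :: "'b \<Rightarrow> real" and X :: "'i \<Rightarrow> 'a \<Rightarrow> real" and Z :: "'i \<Rightarrow> 'b \<Rightarrow> real"
  assumes "finite I"
    and "integrable M w" "\<And>x. 0 \<le> w x" "integrable N v" "\<And>x. 0 \<le> v x"
    and "\<And>i. i \<in> I \<Longrightarrow> X i \<in> borel_measurable M" "\<And>i. i \<in> I \<Longrightarrow> Z i \<in> borel_measurable N"
    and "\<And>t. (CLINT x|M. w x *\<^sub>R iexp (\<Sum>i\<in>I. t i * X i x)) = (CLINT x|N. v x *\<^sub>R iexp (\<Sum>i\<in>I. t i * Z i x))"
    and "\<And>i. i \<in> I \<Longrightarrow> B i \<in> sets borel"
  shows "(\<integral>x. w x * (\<Prod>i\<in>I. indicator (B i) (X i x)) \<partial>M) = (\<integral>x. v x * (\<Prod>i\<in>I. indicator (B i) (Z i x)) \<partial>N)"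
  using assms
proof (induction I arbitrary: w v rule: finite_induct)
  case empty
  have "complex_of_real (\<integral>x. w x \<partial>M) = complex_of_real (\<integral>x. v x \<partial>N)"
    using empty.prems(7) by (simp add: scaleR_conv_of_real)
  thus ?case by (simp only: of_real_eq_iff) simp
next
  case (insert k I)
  note w = insert.prems(1,2) and v = insert.prems(3,4) and ch = insert.prems(7)
  have [measurable]: "w \<in> borel_measurable M" "v \<in> borel_measurable N" using w v by auto
  have [measurable]: "X k \<in> borel_measurable M" "Z k \<in> borel_measurable N" "B k \<in> sets borel"
    "\<And>i. i \<in> I \<Longrightarrow> X i \<in> borel_measurable M" "\<And>i. i \<in> I \<Longrightarrow> Z i \<in> borel_measurable N"
    using insert.prems by auto
  \<comment> \<open>Expanding the cosine into exponentials expresses the transform by joint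
    characteristic functions at three vectors: \<open>s\<close> in coordinate \<open>k\<close>,
    together with 0, \<open>t\<close> or \<open>- t\<close> on \<open>I\<close>.\<close>
  have trig: "(CLINT x|K. (u x * (1 + cos ((\<Sum>i\<in>I. t i * U i x) + \<theta>))) *\<^sub>R iexp (s * U k x))
     = (CLINT x|K. u x *\<^sub>R iexp (\<Sum>i\<in>insert k I. (if i = k then s else 0) * U i x))
       + iexp \<theta> / 2 * (CLINT x|K. u x *\<^sub>R iexp (\<Sum>i\<in>insert k I. (t(k := s)) i * U i x))
       + iexp (- \<theta>) / 2 * (CLINT x|K. u x *\<^sub>R iexp (\<Sum>i\<in>insert k I. ((\<lambda>i. - t i)(k := s)) i * U i x))"
    if u: "integrable K u" and [measurable]: "\<And>i. i \<in> insert k I \<Longrightarrow> U i \<in> borel_measurable K"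
    for K :: "'c measure" and u U t s \<theta>
  proof -
    have int: "complex_integrable K (\<lambda>x. u x *\<^sub>R iexp (\<Sum>i\<in>insert k I. t' i * U i x))" for t'
      by (intro integrable_scaleR_iexp u) auto
    have sm: "(\<Sum>i\<in>insert k I. (t'(k := s)) i * U i x) = s * U k x + (\<Sum>i\<in>I. t' i * U i x)" for t' x
      using insert.hyps by (auto intro!: sum.cong)
    have s0: "(\<Sum>i\<in>insert k I. (if i = k then s else 0) * U i x) = s * U k x" for x
      using insert.hyps by (auto intro!: sum.neutral)
    have pt: "(u x * (1 + cos ((\<Sum>i\<in>I. t i * U i x) + \<theta>))) *\<^sub>R iexp (s * U k x)
     = u x *\<^sub>R iexp (\<Sum>i\<in>insert k I. (if i = k then s else 0) * U i x)
       + iexp \<theta> / 2 * (u x *\<^sub>R iexp (\<Sum>i\<in>insert k I. (t(k := s)) i * U i x))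
       + iexp (- \<theta>) / 2 * (u x *\<^sub>R iexp (\<Sum>i\<in>insert k I. ((\<lambda>i. - t i)(k := s)) i * U i x))" for x
    proof -
      define p where "p = (\<Sum>i\<in>I. t i * U i x)"
      have n: "(\<Sum>i\<in>I. - t i * U i x) = - p" unfolding p_def by (simp add: sum_negf)
      have cs: "complex_of_real (cos (p + \<theta>)) = (iexp p * iexp \<theta> + iexp (- p) * iexp (- \<theta>)) / 2"
        by (simp add: cos_of_real[symmetric] cos_exp_eq exp_add[symmetric] algebra_simps)
      have e: "iexp (s * U k x + q) = iexp (s * U k x) * iexp q" for q
        by (simp add: exp_add[symmetric] algebra_simps)
      show ?thesis
        unfolding sm s0 n p_def[symmetric] e scaleR_conv_of_real of_real_mult[of "u x" "1 + cos (p + \<theta>)"]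
          of_real_add[of 1 "cos (p + \<theta>)"] cs
        by (simp add: field_simps)
    qed
    have lin: "(CLINT x|K. f x + a * g x + b * h x) = (CLINT x|K. f x) + a * (CLINT x|K. g x) + b * (CLINT x|K. h x)"
      if "complex_integrable K f" "complex_integrable K g" "complex_integrable K h" for f g h a b
      using that by simp
    show ?thesis unfolding pt by (rule lin; rule int)
  qed
  have cosw: "(\<integral>x. w x * (1 + cos ((\<Sum>i\<in>I. t i * X i x) + \<theta>)) * indicator (B k) (X k x) \<partial>M)
            = (\<integral>x. v x * (1 + cos ((\<Sum>i\<in>I. t i * Z i x) + \<theta>)) * indicator (B k) (Z k x) \<partial>N)" for t \<theta>
  proof (rule weighted_char_unique)
    have *: "integrable K (\<lambda>x. u x * (1 + cos (f x)))" if "integrable K u" "f \<in> borel_measurable K"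
      for K :: "'c measure" and u f :: "'c \<Rightarrow> real"
    proof -
      have "\<bar>1 + cos y\<bar> \<le> 2" for y :: real using cos_le_one[of y] cos_ge_minus_one[of y] by linarith
      hence "\<bar>u x\<bar> * \<bar>1 + cos (f x)\<bar> \<le> \<bar>u x\<bar> * 2" for x by (intro mult_left_mono) auto
      thus ?thesis using that
        by (intro Bochner_Integration.integrable_bound[OF integrable_mult_left[OF that(1), of 2]])
           (auto simp: abs_mult)
    qed
    show "integrable M (\<lambda>x. w x * (1 + cos ((\<Sum>i\<in>I. t i * X i x) + \<theta>)))"
      by (intro * w) measurable
    show "integrable N (\<lambda>x. v x * (1 + cos ((\<Sum>i\<in>I. t i * Z i x) + \<theta>)))"
      by (intro * v) measurable
    have "0 \<le> 1 + cos y" for y :: real using cos_ge_minus_one[of y] by linarith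
    thus "0 \<le> w x * (1 + cos ((\<Sum>i\<in>I. t i * X i x) + \<theta>))" "0 \<le> v y * (1 + cos ((\<Sum>i\<in>I. t i * Z i y) + \<theta>))" for x y
      using w v by auto
    show "(CLINT x|M. (w x * (1 + cos ((\<Sum>i\<in>I. t i * X i x) + \<theta>))) *\<^sub>R iexp (s * X k x))
       = (CLINT x|N. (v x * (1 + cos ((\<Sum>i\<in>I. t i * Z i x) + \<theta>))) *\<^sub>R iexp (s * Z k x))" for s
      using insert.prems by (simp only: trig[OF w(1)] trig[OF v(1)] ch)
  qed simp_all
  have one: "(\<integral>x. w x * indicator (B k) (X k x) \<partial>M) = (\<integral>x. v x * indicator (B k) (Z k x) \<partial>N)"
  proof (rule weighted_char_unique[OF w v])
    fix s
    have *: "(\<Sum>i\<in>insert k I. (if i = k then s else 0) * U i) = s * U k" for U :: "'i \<Rightarrow> real"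
      using insert.hyps by (auto intro!: sum.neutral)
    show "(CLINT x|M. w x *\<^sub>R iexp (s * X k x)) = (CLINT x|N. v x *\<^sub>R iexp (s * Z k x))"
      using ch[of "\<lambda>i. if i = k then s else 0"] unfolding * .
  qed auto
  have iw: "integrable M (\<lambda>x. w x * indicator (B k) (X k x))"
    using w by (intro Bochner_Integration.integrable_bound[OF w(1)]) (auto split: split_indicator)
  have iv: "integrable N (\<lambda>x. v x * indicator (B k) (Z k x))"
    using v by (intro Bochner_Integration.integrable_bound[OF v(1)]) (auto split: split_indicator)
  \<comment> \<open>Subtracting \<open>one\<close> removes the summand 1, which served to keep the
    weight nonnegative.\<close>
  have cosw': "(\<integral>x. w x * indicator (B k) (X k x) * cos ((\<Sum>i\<in>I. t i * X i x) + \<theta>) \<partial>M)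
            = (\<integral>x. v x * indicator (B k) (Z k x) * cos ((\<Sum>i\<in>I. t i * Z i x) + \<theta>) \<partial>N)" for t \<theta>
  proof -
    have *: "(\<integral>x. u x * (1 + cos (f x)) * q x \<partial>K) = (\<integral>x. u x * q x \<partial>K) + (\<integral>x. u x * q x * cos (f x) \<partial>K)"
      if "integrable K (\<lambda>x. u x * q x)" and [measurable]: "f \<in> borel_measurable K" for K and u q f :: "'c \<Rightarrow> real"
    proof -
      have "integrable K (\<lambda>x. u x * q x * cos (f x))"
        using that by (intro Bochner_Integration.integrable_bound[OF that(1)]) (auto simp: abs_mult mult_left_le)
      thus ?thesis using that by (subst Bochner_Integration.integral_add[symmetric]) (auto simp: algebra_simps)
    qed
    show ?thesis
      using cosw[of t \<theta>] one by (subst (asm) (1 2) *) (use iw iv in auto)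
  qed
  \<comment> \<open>The phases 0 and \<open>- pi / 2\<close> yield the cosine and sine parts, hence
    the full characteristic function for the weight that has absorbed the indicator.\<close>
  have split: "(CLINT x|K. q x *\<^sub>R iexp (f x)) = complex_of_real (\<integral>x. q x * cos (f x + 0) \<partial>K) + \<i> * complex_of_real (\<integral>x. q x * cos (f x + - pi / 2) \<partial>K)"
    if q: "integrable K q" and [measurable]: "f \<in> borel_measurable K" for K and q f :: "'c \<Rightarrow> real"
  proof -
    have [measurable]: "q \<in> borel_measurable K" using q by auto
    have sc: "cos (y + - pi / 2) = sin y" for y :: real by (simp add: cos_add cos_diff)
    have i: "integrable K (\<lambda>x. q x * cos (f x))" "integrable K (\<lambda>x. q x * sin (f x))"
      using q by (auto intro!: Bochner_Integration.integrable_bound[OF q] simp: abs_mult mult_left_le)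
    have "(CLINT x|K. q x *\<^sub>R iexp (f x)) = (CLINT x|K. complex_of_real (q x * cos (f x)) + \<i> * complex_of_real (q x * sin (f x)))"
      by (intro Bochner_Integration.integral_cong) (auto simp: complex_eq_iff Re_exp Im_exp)
    also have "\<dots> = (CLINT x|K. complex_of_real (q x * cos (f x))) + (CLINT x|K. \<i> * complex_of_real (q x * sin (f x)))"
      using i by (intro Bochner_Integration.integral_add integrable_mult_right integrable_of_real)
    also have "\<dots> = complex_of_real (\<integral>x. q x * cos (f x) \<partial>K) + \<i> * complex_of_real (\<integral>x. q x * sin (f x) \<partial>K)"
      by (simp only: integral_mult_right_zero integral_complex_of_real)
    finally show ?thesis unfolding sc by simp
  qed
  have "(\<integral>x. w x * indicator (B k) (X k x) * (\<Prod>i\<in>I. indicator (B i) (X i x)) \<partial>M)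
      = (\<integral>x. v x * indicator (B k) (Z k x) * (\<Prod>i\<in>I. indicator (B i) (Z i x)) \<partial>N)"
  proof (rule insert.IH[OF iw _ iv])
    show "(CLINT x|M. (w x * indicator (B k) (X k x)) *\<^sub>R iexp (\<Sum>i\<in>I. t i * X i x))
        = (CLINT x|N. (v x * indicator (B k) (Z k x)) *\<^sub>R iexp (\<Sum>i\<in>I. t i * Z i x))" for t
      by (subst (1 2) split) (use iw iv in \<open>simp_all only: cosw', auto\<close>)
  qed (use w v insert.prems in auto)
  thus ?case using insert.hyps by (simp add: mult.assoc)
qed

subsection \<open>Gaussian vectors\<close>

text \<open>The transform at 1 suffices, because multiples of a linear combination are again linear
  combinations. The degenerate case obeys the same formula with second moment 0, so later arguments
  compare second moments without a case distinction.\<close>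

lemma centered_gaussian_rv_moments:
  assumes "prob_space M" "centered_gaussian_rv M Y"
  shows "integrable M (\<lambda>\<omega>. (Y \<omega>)\<^sup>2)"
    and "(CLINT \<omega>|M. iexp (Y \<omega>)) = exp (- (\<integral>\<omega>. (Y \<omega>)\<^sup>2 \<partial>M) / 2)"
proof -
  interpret prob_space M by fact
  have [measurable]: "Y \<in> borel_measurable M" using assms by (simp add: centered_gaussian_rv_def)
  consider "AE \<omega> in M. Y \<omega> = 0" | \<sigma> where "0 < \<sigma>" "distributed M lborel Y (normal_density 0 \<sigma>)"
    using assms by (auto simp: centered_gaussian_rv_def)
  then have "integrable M (\<lambda>\<omega>. (Y \<omega>)\<^sup>2) \<and> (CLINT \<omega>|M. iexp (Y \<omega>)) = exp (- (\<integral>\<omega>. (Y \<omega>)\<^sup>2 \<partial>M) / 2)"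
  proof cases
    case 1
    have "integrable M (\<lambda>\<omega>. (Y \<omega>)\<^sup>2) = integrable M (\<lambda>\<omega>. 0 :: real)"
      by (intro integrable_cong_AE) (use 1 in auto)
    moreover have "(CLINT \<omega>|M. iexp (Y \<omega>)) = (CLINT \<omega>|M. 1)"
      by (intro integral_cong_AE) (use 1 in auto)
    moreover have "(\<integral>\<omega>. (Y \<omega>)\<^sup>2 \<partial>M) = 0"
      by (intro integral_eq_zero_AE) (use 1 in auto)
    ultimately show ?thesis by (simp add: prob_space)
  next
    case 2
    have i: "integrable M (\<lambda>\<omega>. (Y \<omega>)\<^sup>2)"
      using integrable_normal_moment[OF 2(1), of 0 2] distributed_integrable[OF 2(2), of "\<lambda>x. x\<^sup>2"] by simp
    have v: "(\<integral>\<omega>. (Y \<omega>)\<^sup>2 \<partial>M) = \<sigma>\<^sup>2"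
      using normal_distributed_variance[OF 2] normal_distributed_expectation[OF 2] by simp
    have "distributed M lborel (\<lambda>\<omega>. Y \<omega> / \<sigma>) std_normal_density"
      using 2 normal_standard_normal_convert[OF 2(1), of Y 0] by simp
    hence d: "distr M lborel (\<lambda>\<omega>. Y \<omega> / \<sigma>) = std_normal_distribution"
      by (rule distributed_distr_eq_density)
    have "exp (- (\<sigma>\<^sup>2) / 2) = char std_normal_distribution \<sigma>"
      by (simp add: char_std_normal_distribution)
    also have "\<dots> = (CLINT x|distr M lborel (\<lambda>\<omega>. Y \<omega> / \<sigma>). iexp (\<sigma> * x))"
      unfolding d char_def ..
    also have "\<dots> = (CLINT \<omega>|M. iexp (\<sigma> * (Y \<omega> / \<sigma>)))"
      by (subst integral_distr) auto
    also have "\<dots> = (CLINT \<omega>|M. iexp (Y \<omega>))" using 2 by simp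
    finally show ?thesis using i v by simp
  qed
  thus "integrable M (\<lambda>\<omega>. (Y \<omega>)\<^sup>2)" "(CLINT \<omega>|M. iexp (Y \<omega>)) = exp (- (\<integral>\<omega>. (Y \<omega>)\<^sup>2 \<partial>M) / 2)"
    by auto
qed

lemma integrable_mult_of_squares:
  fixes f g :: "'a \<Rightarrow> real"
  assumes [measurable]: "f \<in> borel_measurable M" "g \<in> borel_measurable M"
    and "integrable M (\<lambda>x. (f x)\<^sup>2)" "integrable M (\<lambda>x. (g x)\<^sup>2)"
  shows "integrable M (\<lambda>x. f x * g x)"
proof (rule Bochner_Integration.integrable_bound)
  show "integrable M (\<lambda>x. (f x)\<^sup>2 + (g x)\<^sup>2)" using assms by auto
  have "\<bar>a * b\<bar> \<le> a\<^sup>2 + b\<^sup>2" for a b :: real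
  proof -
    have "2 * (\<bar>a\<bar> * \<bar>b\<bar>) \<le> a\<^sup>2 + b\<^sup>2" using sum_squares_bound[of "\<bar>a\<bar>" "\<bar>b\<bar>"] by simp
    moreover have "0 \<le> \<bar>a\<bar> * \<bar>b\<bar>" by simp
    ultimately show ?thesis unfolding abs_mult by linarith
  qed
  thus "AE x in M. norm (f x * g x) \<le> norm ((f x)\<^sup>2 + (g x)\<^sup>2)" by auto
qed measurable

text \<open>Joint Gaussianity over an arbitrary finite index set, so that coordinates can be split off one at a time.\<close>

definition jointly_gaussian :: "'a measure \<Rightarrow> 'i set \<Rightarrow> ('i \<Rightarrow> 'a \<Rightarrow> real) \<Rightarrow> bool" where
  "jointly_gaussian M I X \<longleftrightarrow> finite I \<and> (\<forall>i\<in>I. X i \<in> borel_measurable M) \<and>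
     (\<forall>c. centered_gaussian_rv M (\<lambda>\<omega>. \<Sum>i\<in>I. c i * X i \<omega>))"

lemma jointly_gaussian_single:
  assumes "jointly_gaussian M I X" "k \<in> I"
  shows "centered_gaussian_rv M (X k)"
proof -
  have "centered_gaussian_rv M (\<lambda>\<omega>. \<Sum>i\<in>I. (if i = k then 1 else 0) * X i \<omega>)"
    using assms unfolding jointly_gaussian_def by (rule_tac spec) auto
  also have "(\<lambda>\<omega>. \<Sum>i\<in>I. (if i = k then 1 else 0) * X i \<omega>) = X k"
  proof
    fix \<omega>
    have "(\<Sum>i\<in>I. (if i = k then 1 else 0) * X i \<omega>) = (\<Sum>i\<in>I. if i = k then X i \<omega> else 0)"
      by (intro sum.cong) auto
    thus "(\<Sum>i\<in>I. (if i = k then 1 else 0) * X i \<omega>) = X k \<omega>"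
      using assms by (simp add: jointly_gaussian_def)
  qed
  finally show ?thesis .
qed

text \<open>A combination of the residuals is a combination of the original coordinates in which
  \<open>X k\<close> receives the weight \<open>- (\<Sum>i\<in>I. t i * c i)\<close>.\<close>

lemma jointly_gaussian_shear:
  assumes X: "jointly_gaussian M (insert k I) X" and k: "k \<notin> I"
  shows "jointly_gaussian M I (\<lambda>i \<omega>. X i \<omega> - c i * X k \<omega>)"
  unfolding jointly_gaussian_def
proof (intro conjI ballI allI)
  have fin: "finite I" using X by (simp add: jointly_gaussian_def)
  show "finite I" by (rule fin)
  show "(\<lambda>\<omega>. X i \<omega> - c i * X k \<omega>) \<in> borel_measurable M" if "i \<in> I" for i
    using X that by (auto simp: jointly_gaussian_def)
  fix t :: "'b \<Rightarrow> real"
  define a where "a = t(k := - (\<Sum>i\<in>I. t i * c i))"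
  have "(\<Sum>i\<in>insert k I. a i * X i \<omega>) = (\<Sum>i\<in>I. t i * (X i \<omega> - c i * X k \<omega>))" for \<omega>
  proof -
    have "(\<Sum>i\<in>insert k I. a i * X i \<omega>) = - (\<Sum>i\<in>I. t i * c i) * X k \<omega> + (\<Sum>i\<in>I. t i * X i \<omega>)"
      using k fin unfolding a_def by (auto intro!: sum.cong)
    also have "\<dots> = (\<Sum>i\<in>I. t i * (X i \<omega> - c i * X k \<omega>))"
      by (simp add: sum_distrib_right right_diff_distrib sum_subtractf mult.assoc)
    finally show ?thesis .
  qed
  thus "centered_gaussian_rv M (\<lambda>\<omega>. \<Sum>i\<in>I. t i * (X i \<omega> - c i * X k \<omega>))"
    using X unfolding jointly_gaussian_def by (metis (no_types, lifting) ext)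
qed

lemma jointly_gaussian_subset:
  assumes "jointly_gaussian M (insert k I) X" "k \<notin> I"
  shows "jointly_gaussian M I X"
  using jointly_gaussian_shear[OF assms, of "\<lambda>_. 0"] by simp

lemma prod_indicator_eq:
  "finite I \<Longrightarrow> (\<Prod>i\<in>I. indicator (B i) (f i) :: real) = (if \<forall>i\<in>I. f i \<in> B i then 1 else 0)"
  by (induction I rule: finite_induct) (auto simp: indicator_def)

lemma (in finite_measure) integral_if_measure:
  assumes "{x\<in>space M. P x} \<in> sets M"
  shows "(\<integral>x. (if P x then 1 else 0 :: real) \<partial>M) = measure M {x\<in>space M. P x}"
proof -
  have "(\<integral>x. (if P x then 1 else 0 :: real) \<partial>M) = (\<integral>x. indicator {x\<in>space M. P x} x \<partial>M)"
    by (intro Bochner_Integration.integral_cong) auto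
  thus ?thesis using assms by simp
qed

text \<open>The vector \<open>X\<close> and the vector \<open>(s, (Y i \<omega> + c i * s)\<^sub>i)\<close>, with \<open>s\<close> an independent copy of \<open>X k\<close>
  and \<open>Y i\<close> the part of \<open>X i\<close> uncorrelated with \<open>X k\<close>, have the same characteristic function.\<close>

lemma gaussian_disintegration:
  assumes P: "prob_space M" and X: "jointly_gaussian M (insert k I) X" and k: "k \<notin> I"
    and \<sigma>: "0 < \<sigma>" and D: "distributed M lborel (X k) (normal_density 0 \<sigma>)"
  shows "\<exists>c. \<forall>B. (\<forall>i\<in>insert k I. B i \<in> sets borel) \<longrightarrow>
       measure M {\<omega>\<in>space M. \<forall>i\<in>insert k I. X i \<omega> \<in> B i} =
       (\<integral>s. normal_density 0 \<sigma> s * (indicator (B k) s *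
          measure M {\<omega>\<in>space M. \<forall>i\<in>I. X i \<omega> - c i * X k \<omega> + c i * s \<in> B i}) \<partial>lborel)"
proof -
  interpret prob_space M by fact
  \<comment> \<open>The regression coefficient of \<open>X i\<close> on \<open>X k\<close>: the one
    multiple of \<open>X k\<close> whose removal leaves \<open>Y i\<close> uncorrelated with
    \<open>X k\<close>.\<close>
  define c where "c = (\<lambda>i. (\<integral>\<omega>. X i \<omega> * X k \<omega> \<partial>M) / \<sigma>\<^sup>2)"
  define Y where "Y = (\<lambda>i \<omega>. X i \<omega> - c i * X k \<omega>)"
  have fin: "finite I" using X by (simp add: jointly_gaussian_def)
  have Xm[measurable]: "X i \<in> borel_measurable M" if "i \<in> insert k I" for i
    using X that by (auto simp: jointly_gaussian_def)
  have Xkm[measurable]: "X k \<in> borel_measurable M" by simp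
  have XmI[measurable]: "X i \<in> borel_measurable M" if "i \<in> I" for i using that by simp
  have Ym[measurable]: "Y i \<in> borel_measurable M" if "i \<in> I" for i
    unfolding Y_def using that by measurable
  have sq: "integrable M (\<lambda>\<omega>. (X i \<omega>)\<^sup>2)" if "i \<in> insert k I" for i
    by (rule centered_gaussian_rv_moments(1)[OF P jointly_gaussian_single[OF X that]])
  have pr: "integrable M (\<lambda>\<omega>. X i \<omega> * X j \<omega>)" if "i \<in> insert k I" "j \<in> insert k I" for i j
    using that by (intro integrable_mult_of_squares sq) auto
  have vk: "(\<integral>\<omega>. X k \<omega> * X k \<omega> \<partial>M) = \<sigma>\<^sup>2"
    using normal_distributed_variance[OF \<sigma> D] normal_distributed_expectation[OF \<sigma> D]
    by (simp add: power2_eq_square)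
  have YG: "jointly_gaussian M I Y" unfolding Y_def by (rule jointly_gaussian_shear[OF X k])
  define \<mu> where "\<mu> = density lborel (normal_density 0 \<sigma>)"
  have dk: "distr M lborel (X k) = \<mu>" unfolding \<mu>_def using D by (rule distributed_distr_eq_density)
  interpret \<mu>: prob_space \<mu> unfolding \<mu>_def by (rule prob_space_normal_density[OF \<sigma>])
  have [simp]: "sets \<mu> = sets borel" "space \<mu> = UNIV" unfolding \<mu>_def by auto
  have [measurable_cong]: "sets \<mu> = sets borel" by simp
  interpret PP: pair_prob_space \<mu> M ..
  \<comment> \<open>The product space supplies the independence: its first factor has the law of
    \<open>X k\<close>, its second carries the residuals.\<close>
  define Z where "Z = (\<lambda>i (p :: real \<times> 'a). if i = k then fst p else Y i (snd p) + c i * fst p)"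
  have Zm: "Z i \<in> borel_measurable (\<mu> \<Otimes>\<^sub>M M)" if "i \<in> insert k I" for i
    using that k unfolding Z_def by (cases "i = k") auto
  have ch: "(CLINT \<omega>|M. 1 *\<^sub>R iexp (\<Sum>i\<in>insert k I. t i * X i \<omega>))
      = (CLINT p|\<mu> \<Otimes>\<^sub>M M. 1 *\<^sub>R iexp (\<Sum>i\<in>insert k I. t i * Z i p))" for t
  proof -
    \<comment> \<open>The total weight of \<open>X k\<close> once every \<open>X i\<close> is
      written as \<open>Y i + c i * X k\<close>; \<open>W\<close> collects the residual
      part.\<close>
    define a where "a = t k + (\<Sum>i\<in>I. t i * c i)"
    define W where "W = (\<lambda>\<omega>. \<Sum>i\<in>I. t i * Y i \<omega>)"
    have [measurable]: "W \<in> borel_measurable M" unfolding W_def by measurable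
    have Wg: "centered_gaussian_rv M W" using YG unfolding W_def jointly_gaussian_def by auto
    have eqX: "(\<Sum>i\<in>insert k I. t i * X i \<omega>) = a * X k \<omega> + W \<omega>" for \<omega>
    proof -
      have "W \<omega> = (\<Sum>i\<in>I. t i * X i \<omega>) - (\<Sum>i\<in>I. t i * c i) * X k \<omega>"
        unfolding W_def Y_def by (simp add: sum_distrib_right right_diff_distrib sum_subtractf mult.assoc)
      thus ?thesis using k fin unfolding a_def by (simp add: algebra_simps)
    qed
    have eqZ: "(\<Sum>i\<in>insert k I. t i * Z i (s, \<omega>)) = a * s + W \<omega>" for s \<omega>
    proof -
      have "(\<Sum>i\<in>I. t i * Z i (s, \<omega>)) = (\<Sum>i\<in>I. t i * Y i \<omega> + t i * c i * s)"
        using k unfolding Z_def by (intro sum.cong) (auto simp: algebra_simps)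
      thus ?thesis using k fin unfolding a_def W_def
        by (simp add: sum.distrib sum_distrib_left Z_def algebra_simps)
    qed
    \<comment> \<open>Here the choice of \<open>c\<close> enters: the cross term of the second
      moment vanishes, so the Gaussian exponential splits into the factor of \<open>a * X k\<close>
      and that of \<open>W\<close>.\<close>
    have uncor: "(\<integral>\<omega>. X k \<omega> * W \<omega> \<partial>M) = 0"
    proof -
      have i: "integrable M (\<lambda>\<omega>. t i * (X i \<omega> * X k \<omega> - c i * (X k \<omega> * X k \<omega>)))" if "i \<in> I" for i
        using that by (intro integrable_mult_right Bochner_Integration.integrable_diff pr) auto
      have "(\<integral>\<omega>. X k \<omega> * W \<omega> \<partial>M) = (\<integral>\<omega>. (\<Sum>i\<in>I. t i * (X i \<omega> * X k \<omega> - c i * (X k \<omega> * X k \<omega>))) \<partial>M)"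
        unfolding W_def Y_def by (intro Bochner_Integration.integral_cong) (auto simp: sum_distrib_left algebra_simps intro!: sum.cong)
      also have "\<dots> = (\<Sum>i\<in>I. t i * ((\<integral>\<omega>. X i \<omega> * X k \<omega> \<partial>M) - c i * (\<integral>\<omega>. X k \<omega> * X k \<omega> \<partial>M)))"
        using i pr by (subst Bochner_Integration.integral_sum) (auto intro!: sum.cong)
      also have "\<dots> = 0" unfolding vk c_def using \<sigma> by simp
      finally show ?thesis .
    qed
    have W2: "integrable M (\<lambda>\<omega>. (W \<omega>)\<^sup>2)" by (rule centered_gaussian_rv_moments(1)[OF P Wg])
    have XW: "integrable M (\<lambda>\<omega>. X k \<omega> * W \<omega>)" by (intro integrable_mult_of_squares sq W2) auto
    have var: "(\<integral>\<omega>. (a * X k \<omega> + W \<omega>)\<^sup>2 \<partial>M) = a\<^sup>2 * \<sigma>\<^sup>2 + (\<integral>\<omega>. (W \<omega>)\<^sup>2 \<partial>M)"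
    proof -
      have "(\<integral>\<omega>. (a * X k \<omega> + W \<omega>)\<^sup>2 \<partial>M) = (\<integral>\<omega>. (a\<^sup>2 * (X k \<omega> * X k \<omega>) + (2 * a) * (X k \<omega> * W \<omega>)) + (W \<omega>)\<^sup>2 \<partial>M)"
        by (intro Bochner_Integration.integral_cong) (auto simp: power2_eq_square algebra_simps)
      also have "\<dots> = (a\<^sup>2 * (\<integral>\<omega>. X k \<omega> * X k \<omega> \<partial>M) + (2 * a) * (\<integral>\<omega>. X k \<omega> * W \<omega> \<partial>M)) + (\<integral>\<omega>. (W \<omega>)\<^sup>2 \<partial>M)"
        using W2 XW pr[of k k] by simp
      finally show ?thesis using uncor vk by simp
    qed
    have gX: "centered_gaussian_rv M (\<lambda>\<omega>. a * X k \<omega> + W \<omega>)"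
      using X unfolding jointly_gaussian_def eqX[symmetric] by blast
    have gk: "centered_gaussian_rv M (\<lambda>\<omega>. a * X k \<omega>)"
    proof -
      have "centered_gaussian_rv M (\<lambda>\<omega>. \<Sum>i\<in>insert k I. (if i = k then a else 0) * X i \<omega>)"
        using X unfolding jointly_gaussian_def by (rule_tac spec) auto
      also have "(\<lambda>\<omega>. \<Sum>i\<in>insert k I. (if i = k then a else 0) * X i \<omega>) = (\<lambda>\<omega>. a * X k \<omega>)"
        using k fin by (intro ext) (auto intro!: sum.neutral)
      finally show ?thesis .
    qed
    have "(CLINT p|\<mu> \<Otimes>\<^sub>M M. iexp (\<Sum>i\<in>insert k I. t i * Z i p)) = (CLINT p|\<mu> \<Otimes>\<^sub>M M. iexp (a * fst p) * iexp (W (snd p)))"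
    proof -
      have "iexp (\<Sum>i\<in>insert k I. t i * Z i p) = iexp (a * fst p) * iexp (W (snd p))" for p
      proof -
        have "(\<Sum>i\<in>insert k I. t i * Z i p) = a * fst p + W (snd p)"
          using eqZ[of "fst p" "snd p"] by simp
        thus ?thesis by (simp only: of_real_add distrib_left exp_add)
      qed
      thus ?thesis by simp
    qed
    also have "\<dots> = (CLINT s|\<mu>. CLINT \<omega>|M. iexp (a * s) * iexp (W \<omega>))"
    proof (subst PP.integral_fst'[symmetric])
      show "complex_integrable (\<mu> \<Otimes>\<^sub>M M) (\<lambda>p. iexp (a * fst p) * iexp (W (snd p)))"
        by (intro PP.integrable_const_bound[where B=1]) (auto simp: norm_mult)
    qed simp
    also have "\<dots> = (CLINT s|\<mu>. iexp (a * s)) * (CLINT \<omega>|M. iexp (W \<omega>))"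
      by simp
    also have "(CLINT s|\<mu>. iexp (a * s)) = (CLINT \<omega>|M. iexp (a * X k \<omega>))"
      unfolding dk[symmetric] by (subst integral_distr) auto
    also have "\<dots> = exp (- (a\<^sup>2 * \<sigma>\<^sup>2) / 2)"
    proof -
      have "(\<integral>\<omega>. (a * X k \<omega>)\<^sup>2 \<partial>M) = (\<integral>\<omega>. a\<^sup>2 * (X k \<omega> * X k \<omega>) \<partial>M)"
        by (intro Bochner_Integration.integral_cong) (auto simp: power2_eq_square)
      also have "\<dots> = a\<^sup>2 * \<sigma>\<^sup>2" using vk by simp
      finally show ?thesis unfolding centered_gaussian_rv_moments(2)[OF P gk] by simp
    qed
    also have "(CLINT \<omega>|M. iexp (W \<omega>)) = exp (- (\<integral>\<omega>. (W \<omega>)\<^sup>2 \<partial>M) / 2)"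
      by (rule centered_gaussian_rv_moments(2)[OF P Wg])
    also have "complex_of_real (exp (- (a\<^sup>2 * \<sigma>\<^sup>2) / 2)) * complex_of_real (exp (- (\<integral>\<omega>. (W \<omega>)\<^sup>2 \<partial>M) / 2))
       = exp (- (\<integral>\<omega>. (a * X k \<omega> + W \<omega>)\<^sup>2 \<partial>M) / 2)"
      unfolding var of_real_mult[symmetric] exp_add[symmetric] by (simp add: add_divide_distrib)
    also have "\<dots> = (CLINT \<omega>|M. iexp (\<Sum>i\<in>insert k I. t i * X i \<omega>))"
      unfolding eqX by (rule centered_gaussian_rv_moments(2)[OF P gX, symmetric])
    finally show ?thesis by simp
  qed
  show ?thesis
  proof (intro exI allI impI)
    fix B :: "'b \<Rightarrow> real set"
    assume B: "\<forall>i\<in>insert k I. B i \<in> sets borel"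
    have Bk[measurable]: "B k \<in> sets borel" "\<And>i. i \<in> I \<Longrightarrow> B i \<in> sets borel" using B by auto
    have "measure M {\<omega>\<in>space M. \<forall>i\<in>insert k I. X i \<omega> \<in> B i} = (\<integral>\<omega>. (if \<forall>i\<in>insert k I. X i \<omega> \<in> B i then 1 else 0) \<partial>M)"
      by (subst integral_if_measure) (use fin in \<open>auto intro!: measurable\<close>)
    also have "\<dots> = (\<integral>\<omega>. 1 * (\<Prod>i\<in>insert k I. indicator (B i) (X i \<omega>)) \<partial>M)"
      using fin by (subst prod_indicator_eq) auto
    also have "\<dots> = (\<integral>p. 1 * (\<Prod>i\<in>insert k I. indicator (B i) (Z i p)) \<partial>(\<mu> \<Otimes>\<^sub>M M))"
      by (rule joint_char_unique) (use fin ch B Zm in auto)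
    also have "\<dots> = (\<integral>p. indicator (B k) (fst p) * (\<Prod>i\<in>I. indicator (B i) (Y i (snd p) + c i * fst p)) \<partial>(\<mu> \<Otimes>\<^sub>M M))"
      using k fin by (intro Bochner_Integration.integral_cong) (auto simp: Z_def intro!: prod.cong)
    also have "\<dots> = (\<integral>s. \<integral>\<omega>. indicator (B k) s * (\<Prod>i\<in>I. indicator (B i) (Y i \<omega> + c i * s)) \<partial>M \<partial>\<mu>)"
    proof (subst PP.integral_fst'[symmetric])
      show "integrable (\<mu> \<Otimes>\<^sub>M M) (\<lambda>p. indicator (B k) (fst p) * (\<Prod>i\<in>I. indicator (B i) (Y i (snd p) + c i * fst p) :: real))"
        using fin by (intro PP.integrable_const_bound[where B=1])
          (auto simp: abs_mult prod_indicator_eq split: split_indicator)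
    qed simp
    also have "\<dots> = (\<integral>s. indicator (B k) s * measure M {\<omega>\<in>space M. \<forall>i\<in>I. Y i \<omega> + c i * s \<in> B i} \<partial>\<mu>)"
    proof (intro Bochner_Integration.integral_cong refl)
      fix s
      have "(\<integral>\<omega>. (\<Prod>i\<in>I. indicator (B i) (Y i \<omega> + c i * s)) \<partial>M) = measure M {\<omega>\<in>space M. \<forall>i\<in>I. Y i \<omega> + c i * s \<in> B i}"
        unfolding prod_indicator_eq[OF fin] by (subst integral_if_measure) (use fin in \<open>auto intro!: measurable\<close>)
      thus "(\<integral>\<omega>. indicator (B k) s * (\<Prod>i\<in>I. indicator (B i) (Y i \<omega> + c i * s)) \<partial>M)
         = indicator (B k) s * measure M {\<omega>\<in>space M. \<forall>i\<in>I. Y i \<omega> + c i * s \<in> B i}"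
        by simp
    qed
    also have "\<dots> = (\<integral>s. normal_density 0 \<sigma> s * (indicator (B k) s * measure M {\<omega>\<in>space M. \<forall>i\<in>I. Y i \<omega> + c i * s \<in> B i}) \<partial>lborel)"
    proof -
      have "(\<lambda>s. indicator (B k) s * measure M {\<omega>\<in>space M. \<forall>i\<in>I. Y i \<omega> + c i * s \<in> B i}) \<in> borel_measurable lborel"
      proof -
        have "(\<lambda>s. measure M {\<omega>\<in>space M. \<forall>i\<in>I. Y i \<omega> + c i * s \<in> B i})
           = (\<lambda>s. \<integral>\<omega>. (\<Prod>i\<in>I. indicator (B i) (Y i \<omega> + c i * s)) \<partial>M)"
          unfolding prod_indicator_eq[OF fin] by (subst integral_if_measure) (use fin in \<open>auto intro!: measurable\<close>)
        also have "\<dots> \<in> borel_measurable lborel"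
          by (intro borel_measurable_lebesgue_integral) measurable
        finally show ?thesis by measurable
      qed
      thus ?thesis unfolding \<mu>_def by (subst integral_density) auto
    qed
    finally show "measure M {\<omega>\<in>space M. \<forall>i\<in>insert k I. X i \<omega> \<in> B i} = (\<integral>s. normal_density 0 \<sigma> s * (indicator (B k) s *
          measure M {\<omega>\<in>space M. \<forall>i\<in>I. X i \<omega> - c i * X k \<omega> + c i * s \<in> B i}) \<partial>lborel)"
      unfolding Y_def .
  qed
qed

subsection \<open>Log-concavity of box probabilities\<close>

text \<open>The shift is a separate argument because conditioning on one coordinate moves the
  centres of the remaining intervals, and because log-concavity is a statement about the dependence
  on \<open>u\<close>.\<close>

definition box_prob :: "'a measure \<Rightarrow> 'i set \<Rightarrow> ('i \<Rightarrow> 'a \<Rightarrow> real) \<Rightarrow> ('i \<Rightarrow> real) \<Rightarrow> ('i \<Rightarrow> real) \<Rightarrow> real" where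
  "box_prob M I X r u = measure M {\<omega>\<in>space M. \<forall>i\<in>I. \<bar>X i \<omega> + u i\<bar> \<le> r i}"

lemma box_prob_nonneg[simp]: "0 \<le> box_prob M I X r u"
  by (simp add: box_prob_def)

lemma (in prob_space) box_prob_le_1[simp]: "box_prob M I X r u \<le> 1"
  by (simp add: box_prob_def)

lemma (in prob_space) box_prob_line_measurable:
  assumes "finite I" and [measurable]: "\<And>i. i \<in> I \<Longrightarrow> X i \<in> borel_measurable M"
  shows "(\<lambda>s. box_prob M I X r (\<lambda>i. u i + s * c i)) \<in> borel_measurable borel"
proof -
  have abs: "\<bar>y\<bar> \<le> b \<longleftrightarrow> y \<in> {- b..b}" for y b :: real by auto
  have "(\<lambda>s. box_prob M I X r (\<lambda>i. u i + s * c i))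
      = (\<lambda>s. \<integral>\<omega>. (\<Prod>i\<in>I. indicator {- r i..r i} (X i \<omega> + (u i + s * c i))) \<partial>M)"
    unfolding prod_indicator_eq[OF assms(1)] box_prob_def abs
    by (subst integral_if_measure) (use assms(1) in \<open>auto intro!: measurable\<close>)
  also have "\<dots> \<in> borel_measurable borel"
    by (intro borel_measurable_lebesgue_integral) measurable
  finally show ?thesis .
qed

lemma normal_density_log_concave:
  assumes "0 < l" "l < 1" "0 < \<sigma>"
  shows "normal_density 0 \<sigma> x powr l * normal_density 0 \<sigma> y powr (1 - l) \<le> normal_density 0 \<sigma> (l * x + (1 - l) * y)"
proof -
  have "l * x\<^sup>2 + (1 - l) * y\<^sup>2 - (l * x + (1 - l) * y)\<^sup>2 = l * (1 - l) * (x - y)\<^sup>2"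
    by (simp add: power2_eq_square algebra_simps)
  moreover have "0 \<le> l * (1 - l) * (x - y)\<^sup>2" using assms by simp
  ultimately have sq: "(l * x + (1 - l) * y)\<^sup>2 \<le> l * x\<^sup>2 + (1 - l) * y\<^sup>2" by linarith
  define C where "C = 1 / sqrt (2 * pi * \<sigma>\<^sup>2)"
  have C: "0 < C" using assms by (simp add: C_def)
  have nd: "normal_density 0 \<sigma> z = C * exp (- z\<^sup>2 / (2 * \<sigma>\<^sup>2))" for z
    by (simp add: normal_density_def C_def)
  have "normal_density 0 \<sigma> x powr l * normal_density 0 \<sigma> y powr (1 - l)
     = (C powr l * C powr (1 - l)) * (exp (l * (- x\<^sup>2 / (2 * \<sigma>\<^sup>2))) * exp ((1 - l) * (- y\<^sup>2 / (2 * \<sigma>\<^sup>2))))"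
    unfolding nd using C by (simp add: powr_mult powr_def[of "exp _"])
  also have "\<dots> = C * exp (- (l * x\<^sup>2 + (1 - l) * y\<^sup>2) / (2 * \<sigma>\<^sup>2))"
    using C assms by (simp add: powr_add[symmetric] exp_add[symmetric] field_simps)
  also have "\<dots> \<le> C * exp (- (l * x + (1 - l) * y)\<^sup>2 / (2 * \<sigma>\<^sup>2))"
  proof -
    have "- (l * x\<^sup>2 + (1 - l) * y\<^sup>2) / (2 * \<sigma>\<^sup>2) \<le> - (l * x + (1 - l) * y)\<^sup>2 / (2 * \<sigma>\<^sup>2)"
      using sq assms by (intro divide_right_mono) auto
    thus ?thesis using C by (intro mult_left_mono) auto
  qed
  finally show ?thesis unfolding nd .
qed

lemma normal_density_bound:
  assumes "0 < \<sigma>" shows "normal_density 0 \<sigma> x \<le> 1 / sqrt (2 * pi * \<sigma>\<^sup>2)"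
  using assms by (auto simp: normal_density_def divide_right_mono)

text \<open>Convexity of the interval \<open>[-r, r]\<close>. If \<open>u\<close> or
  \<open>v\<close> lies outside it, the left side is 0 because \<open>0 powr a = 0\<close>.\<close>

lemma box_indicator_log_concave:
  fixes x y u v :: real
  assumes "0 < l" "l < 1"
  shows "indicator {x. \<bar>x\<bar> \<le> r} u powr l * indicator {x. \<bar>x\<bar> \<le> r} v powr (1 - l)
     \<le> (indicator {x. \<bar>x\<bar> \<le> r} (l * u + (1 - l) * v) :: real)"
proof (cases "\<bar>u\<bar> \<le> r \<and> \<bar>v\<bar> \<le> r")
  case True
  have "\<bar>l * u + (1 - l) * v\<bar> \<le> l * \<bar>u\<bar> + (1 - l) * \<bar>v\<bar>"
    using assms by (intro order_trans[OF abs_triangle_ineq]) (auto simp: abs_mult)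
  also have "\<dots> \<le> l * r + (1 - l) * r" using True assms by (intro add_mono mult_left_mono) auto
  finally show ?thesis using True by (simp add: algebra_simps)
qed (use assms in auto)

text \<open>Marginals of log-concave functions are log-concave. For nondegenerate \<open>X k\<close>
  the box probability is an integral over \<open>s\<close> whose integrand is log-concave jointly in
  the shift and \<open>s\<close>; Prekopa-Leindler in \<open>s\<close>, at fixed \<open>u\<close>
  and \<open>v\<close>, gives the claim. The induction generalizes over the vector since its
  hypothesis is applied to the residuals \<open>Y\<close>.\<close>

lemma box_prob_log_concave:
  assumes P: "prob_space M" and X: "jointly_gaussian M I X" and l: "0 < l" "l < 1"
  shows "box_prob M I X r u powr l * box_prob M I X r v powr (1 - l)
      \<le> box_prob M I X r (\<lambda>i. l * u i + (1 - l) * v i)"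
proof -
  interpret prob_space M by fact
  have "finite I" using X by (simp add: jointly_gaussian_def)
  thus ?thesis using X l
  proof (induction I arbitrary: X u v l rule: finite_induct)
    case empty
    show ?case by (simp add: box_prob_def prob_space)
  next
    case (insert k I)
    note X = insert.prems(1) and l = insert.prems(2,3) and k = insert.hyps(2) and fin = insert.hyps(1)
    let ?w = "\<lambda>i. l * u i + (1 - l) * v i"
    have Xm[measurable]: "X k \<in> borel_measurable M" "\<And>i. i \<in> I \<Longrightarrow> X i \<in> borel_measurable M"
      using X by (auto simp: jointly_gaussian_def)
    have "centered_gaussian_rv M (X k)" by (rule jointly_gaussian_single[OF X]) simp
    then consider "AE \<omega> in M. X k \<omega> = 0" | \<sigma> where "0 < \<sigma>" "distributed M lborel (X k) (normal_density 0 \<sigma>)"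
      by (auto simp: centered_gaussian_rv_def)
    thus ?case
    proof cases
      case 1
      \<comment> \<open>A coordinate that is almost surely zero leaves only a deterministic
        constraint on its shift, the indicator of an interval.\<close>
      have drop: "box_prob M (insert k I) X r u' = indicator {x. \<bar>x\<bar> \<le> r k} (u' k) * box_prob M I X r u'" for u'
      proof -
        have "box_prob M (insert k I) X r u' = measure M {\<omega>\<in>space M. \<bar>u' k\<bar> \<le> r k \<and> (\<forall>i\<in>I. \<bar>X i \<omega> + u' i\<bar> \<le> r i)}"
          unfolding box_prob_def by (rule measure_eq_AE) (use 1 fin in auto)
        also have "\<dots> = indicator {x. \<bar>x\<bar> \<le> r k} (u' k) * box_prob M I X r u'"
          by (cases "\<bar>u' k\<bar> \<le> r k") (auto simp: box_prob_def)
        finally show ?thesis .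
      qed
      have "box_prob M (insert k I) X r u powr l * box_prob M (insert k I) X r v powr (1 - l)
         = (indicator {x. \<bar>x\<bar> \<le> r k} (u k) powr l * indicator {x. \<bar>x\<bar> \<le> r k} (v k) powr (1 - l))
           * (box_prob M I X r u powr l * box_prob M I X r v powr (1 - l))"
        unfolding drop by (simp add: powr_mult)
      also have "\<dots> \<le> indicator {x. \<bar>x\<bar> \<le> r k} (?w k) * box_prob M I X r ?w"
        by (intro mult_mono box_indicator_log_concave l insert.IH jointly_gaussian_subset[OF X k]) auto
      finally show ?thesis unfolding drop .
    next
      case 2
      note \<sigma> = 2(1)
      obtain c where c: "\<forall>B. (\<forall>i\<in>insert k I. B i \<in> sets borel) \<longrightarrow>
         measure M {\<omega>\<in>space M. \<forall>i\<in>insert k I. X i \<omega> \<in> B i} =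
         (\<integral>s. normal_density 0 \<sigma> s * (indicator (B k) s *
            measure M {\<omega>\<in>space M. \<forall>i\<in>I. X i \<omega> - c i * X k \<omega> + c i * s \<in> B i}) \<partial>lborel)"
        using gaussian_disintegration[OF P X k 2] by (elim exE)
      define Y where "Y = (\<lambda>i \<omega>. X i \<omega> - c i * X k \<omega>)"
      have Y: "jointly_gaussian M I Y" unfolding Y_def by (rule jointly_gaussian_shear[OF X k])
      have Ym: "Y i \<in> borel_measurable M" if "i \<in> I" for i
        using Y that by (simp add: jointly_gaussian_def)
      define \<Phi> where "\<Phi> = (\<lambda>u' s. normal_density 0 \<sigma> s * (indicator {x. \<bar>x\<bar> \<le> r k} (s + u' k) * box_prob M I Y r (\<lambda>i. u' i + s * c i)))"
      have rep: "box_prob M (insert k I) X r u' = (\<integral>s. \<Phi> u' s \<partial>lborel)" for u'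
      proof -
        define B where "B = (\<lambda>i. {x. \<bar>x + u' i\<bar> \<le> r i})"
        have "\<forall>i\<in>insert k I. B i \<in> sets borel" unfolding B_def by measurable
        hence "measure M {\<omega>\<in>space M. \<forall>i\<in>insert k I. X i \<omega> \<in> B i} =
          (\<integral>s. normal_density 0 \<sigma> s * (indicator (B k) s *
            measure M {\<omega>\<in>space M. \<forall>i\<in>I. Y i \<omega> + c i * s \<in> B i}) \<partial>lborel)"
          using c unfolding Y_def by blast
        moreover have "normal_density 0 \<sigma> s * (indicator (B k) s *
            measure M {\<omega>\<in>space M. \<forall>i\<in>I. Y i \<omega> + c i * s \<in> B i}) = \<Phi> u' s" for s
          unfolding \<Phi>_def box_prob_def B_def by (simp add: indicator_def algebra_simps)
        ultimately show ?thesis unfolding box_prob_def B_def by simp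
      qed
      \<comment> \<open>Stated for arbitrary weights and pairs of shifts because it is used twice:
        as the hypothesis of Prekopa-Leindler, and with equal shifts to show that superlevel sets
        are convex.\<close>
      have lc: "\<Phi> u1 x powr l' * \<Phi> u2 y powr (1 - l') \<le> \<Phi> (\<lambda>i. l' * u1 i + (1 - l') * u2 i) (l' * x + (1 - l') * y)"
        if l': "0 < l'" "l' < 1" for u1 u2 x y l'
      proof -
        let ?w' = "\<lambda>i. l' * u1 i + (1 - l') * u2 i" and ?z = "l' * x + (1 - l') * y"
        have eqz: "l' * (x + u1 k) + (1 - l') * (y + u2 k) = ?z + ?w' k"
          "(\<lambda>i. l' * (u1 i + x * c i) + (1 - l') * (u2 i + y * c i)) = (\<lambda>i. ?w' i + ?z * c i)"
          by (auto simp: algebra_simps)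
        have "\<Phi> u1 x powr l' * \<Phi> u2 y powr (1 - l')
          = (normal_density 0 \<sigma> x powr l' * normal_density 0 \<sigma> y powr (1 - l'))
           * ((indicator {x. \<bar>x\<bar> \<le> r k} (x + u1 k) powr l' * indicator {x. \<bar>x\<bar> \<le> r k} (y + u2 k) powr (1 - l'))
           * (box_prob M I Y r (\<lambda>i. u1 i + x * c i) powr l' * box_prob M I Y r (\<lambda>i. u2 i + y * c i) powr (1 - l')))"
          unfolding \<Phi>_def by (simp add: powr_mult)
        also have "\<dots> \<le> normal_density 0 \<sigma> ?z * (indicator {x. \<bar>x\<bar> \<le> r k} (l' * (x + u1 k) + (1 - l') * (y + u2 k))
           * box_prob M I Y r (\<lambda>i. l' * (u1 i + x * c i) + (1 - l') * (u2 i + y * c i)))"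
          by (intro mult_mono mult_nonneg_nonneg normal_density_log_concave box_indicator_log_concave insert.IH Y l' \<sigma>) auto
        finally show ?thesis unfolding eqz \<Phi>_def .
      qed
      have meas: "\<Phi> u' \<in> borel_measurable borel" for u'
        using box_prob_line_measurable[OF fin Ym, where r = r and u = u' and c = c] unfolding \<Phi>_def by measurable
      have nn: "0 \<le> \<Phi> u' s" for u' s unfolding \<Phi>_def by simp
      have le_nd: "\<Phi> u' s \<le> normal_density 0 \<sigma> s" for u' s
      proof -
        have "indicator {x. \<bar>x\<bar> \<le> r k} (s + u' k) * box_prob M I Y r (\<lambda>i. u' i + s * c i) \<le> 1 * 1"
          by (intro mult_mono) (auto split: split_indicator)
        thus ?thesis unfolding \<Phi>_def by (intro mult_left_le) auto
      qed
      have int: "is_interval {s. t < \<Phi> u' s}" if t: "0 < t" for t u'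
        unfolding is_interval_convex_1
      proof (rule convexI)
        fix x y a b :: real
        assume xy: "x \<in> {s. t < \<Phi> u' s}" "y \<in> {s. t < \<Phi> u' s}" and ab: "0 \<le> a" "0 \<le> b" "a + b = 1"
        show "a *\<^sub>R x + b *\<^sub>R y \<in> {s. t < \<Phi> u' s}"
        \<comment> \<open>\<open>lc\<close> covers only weights strictly between 0 and 1; at the
          ends the combination is \<open>x\<close> or \<open>y\<close> itself.\<close>
        proof (cases "a = 0 \<or> b = 0")
          case True
          thus ?thesis using xy ab by auto
        next
          case False
          hence a: "0 < a" "a < 1" and b: "b = 1 - a" using ab by auto
          have "t = t powr a * t powr (1 - a)" using t by (simp add: powr_add[symmetric])
          also have "\<dots> < \<Phi> u' x powr a * \<Phi> u' y powr (1 - a)"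
            using xy t a by (intro mult_strict_mono powr_less_mono2) auto
          also have "\<dots> \<le> \<Phi> (\<lambda>i. a * u' i + (1 - a) * u' i) (a * x + (1 - a) * y)" by (rule lc[OF a])
          also have "(\<lambda>i. a * u' i + (1 - a) * u' i) = u'" by (auto simp: algebra_simps)
          finally show ?thesis unfolding b by simp
        qed
      qed
      have bd: "bounded {s. \<Phi> u' s \<noteq> 0}" for u'
      proof (rule bounded_subset)
        show "{s. \<Phi> u' s \<noteq> 0} \<subseteq> {- r k - u' k..r k - u' k}"
          unfolding \<Phi>_def by (auto split: split_indicator)
      qed simp
      have intg: "integrable lborel (\<Phi> u')" for u'
        by (rule Bochner_Integration.integrable_bound[OF integrable_normal_density[OF \<sigma>, of 0]])
           (use meas nn le_nd in auto)
      show ?thesis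
        unfolding rep
        by (rule prekopa_leindler_interval[where K = "1 / sqrt (2 * pi * \<sigma>\<^sup>2)"])
           (use l meas intg nn int bd lc order_trans[OF le_nd normal_density_bound[OF \<sigma>]] in auto)
    qed
  qed
qed

subsection \<open>Conditioning on a slab\<close>

text \<open>A combination and its negative have the same second moment, so \<open>X\<close> and
  \<open>- X\<close> have the same joint characteristic function and the same box probabilities. The
  sign is then moved from the vector to the shift.\<close>

lemma box_prob_uminus:
  assumes P: "prob_space M" and X: "jointly_gaussian M I X"
  shows "box_prob M I X r (\<lambda>i. - u i) = box_prob M I X r u"
proof -
  interpret prob_space M by fact
  have fin: "finite I" using X by (simp add: jointly_gaussian_def)
  have [measurable]: "X i \<in> borel_measurable M" if "i \<in> I" for i
    using X that by (simp add: jointly_gaussian_def)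
  have g: "centered_gaussian_rv M (\<lambda>\<omega>. \<Sum>i\<in>I. t i * X i \<omega>)" for t
    using X by (simp add: jointly_gaussian_def)
  have n: "(\<Sum>i\<in>I. t i * (- X i \<omega>)) = (\<Sum>i\<in>I. - t i * X i \<omega>)" "(\<Sum>i\<in>I. - t i * X i \<omega>) = - (\<Sum>i\<in>I. t i * X i \<omega>)" for t \<omega>
    by (simp_all add: sum_negf)
  have ch: "(CLINT \<omega>|M. 1 *\<^sub>R iexp (\<Sum>i\<in>I. t i * X i \<omega>)) = (CLINT \<omega>|M. 1 *\<^sub>R iexp (\<Sum>i\<in>I. t i * (- X i \<omega>)))" for t
    using centered_gaussian_rv_moments(2)[OF P g, of t] centered_gaussian_rv_moments(2)[OF P g, of "\<lambda>i. - t i"]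
    unfolding n(1) by (simp only: scaleR_one n(2) power2_minus)
  have box: "box_prob M I Z r v = (\<integral>\<omega>. 1 * (\<Prod>i\<in>I. indicator {x. \<bar>x + v i\<bar> \<le> r i} (Z i \<omega>)) \<partial>M)"
    if [measurable]: "\<And>i. i \<in> I \<Longrightarrow> Z i \<in> borel_measurable M" for Z v
    unfolding prod_indicator_eq[OF fin] box_prob_def mult_1
    by (subst integral_if_measure) (use fin in \<open>auto intro!: measurable\<close>)
  have "box_prob M I X r u = box_prob M I (\<lambda>i \<omega>. - X i \<omega>) r u"
    by (subst (1 2) box, simp, simp, rule joint_char_unique) (use fin ch in auto)
  also have "\<bar>- x + y\<bar> = \<bar>x + - y\<bar>" for x y :: real by simp
  hence "box_prob M I (\<lambda>i \<omega>. - X i \<omega>) r u = box_prob M I X r (\<lambda>i. - u i)"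
    unfolding box_prob_def by simp
  finally show ?thesis by simp
qed

text \<open>The point \<open>s * u\<close> is a convex combination of \<open>t * u\<close> and its
  reflection, where the values agree by symmetry; log-concavity bounds the value at
  \<open>s * u\<close> from below by this common value.\<close>

lemma box_prob_shift_antimono:
  assumes P: "prob_space M" and X: "jointly_gaussian M I X" and st: "\<bar>s\<bar> \<le> \<bar>t\<bar>"
  shows "box_prob M I X r (\<lambda>i. t * u i) \<le> box_prob M I X r (\<lambda>i. s * u i)"
\<comment> \<open>In the case of equality the weight \<open>l\<close> below would be 0 or 1, or
  \<open>t\<close> would be 0.\<close>
proof (cases "\<bar>s\<bar> = \<bar>t\<bar>")
  case True
  hence "s = t \<or> s = - t" by arith
  thus ?thesis using box_prob_uminus[OF P X, of r "\<lambda>i. t * u i"] by auto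
next
  case False
  hence lt: "\<bar>s\<bar> < \<bar>t\<bar>" using st by simp
  \<comment> \<open>The solution of \<open>l * t - (1 - l) * t = s\<close>.\<close>
  define l where "l = (1 + s / t) / 2"
  have "\<bar>s / t\<bar> < 1" using lt by (simp add: abs_divide)
  hence "- 1 < s / t" "s / t < 1" by linarith+
  hence l: "0 < l" "l < 1" unfolding l_def by simp_all
  have *: "l * (t * y) + (1 - l) * - (t * y) = s * y" for y
  proof -
    have "l * (t * y) + (1 - l) * - (t * y) = (2 * l - 1) * t * y" by (simp add: algebra_simps)
    also have "2 * l - 1 = s / t" by (simp only: l_def) argo
    also have "s / t * t * y = s * y" using lt by auto
    finally show ?thesis .
  qed
  let ?G = "\<lambda>u. box_prob M I X r u"
  have "?G (\<lambda>i. t * u i) = ?G (\<lambda>i. t * u i) powr l * ?G (\<lambda>i. t * u i) powr (1 - l)"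
    by (simp add: powr_add[symmetric])
  also have "\<dots> = ?G (\<lambda>i. t * u i) powr l * ?G (\<lambda>i. - (t * u i)) powr (1 - l)"
    by (simp only: box_prob_uminus[OF P X])
  also have "\<dots> \<le> ?G (\<lambda>i. s * u i)"
    using box_prob_log_concave[OF P X l, of r "\<lambda>i. t * u i" "\<lambda>i. - (t * u i)"] unfolding * .
  finally show ?thesis .
qed

text \<open>The average of \<open>g\<close> over \<open>A\<close> is at least \<open>m\<close> and
  that over \<open>B - A\<close> at most \<open>m\<close>, so enlarging \<open>A\<close> to
  \<open>B\<close> cannot raise the average. The cross-multiplied form stays meaningful for null
  sets.\<close>

lemma (in finite_measure) average_mono:
  fixes g :: "'a \<Rightarrow> real"
  assumes g: "integrable M g" and A: "A \<in> sets M" and B: "B \<in> sets M" and AB: "A \<subseteq> B"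
    and ge: "\<And>x. x \<in> A \<Longrightarrow> m \<le> g x" and le: "\<And>x. x \<in> B - A \<Longrightarrow> g x \<le> m"
  shows "measure M A * (\<integral>x. indicator B x * g x \<partial>M) \<le> measure M B * (\<integral>x. indicator A x * g x \<partial>M)"
proof -
  have iA: "integrable M (\<lambda>x. indicator S x * g x)" if "S \<in> sets M" for S
    using integrable_real_mult_indicator[OF that g] by (simp add: mult.commute)
  have ind: "integrable M (\<lambda>x. indicator S x * m)" if "S \<in> sets M" for S
    using that by (intro integrable_mult_left integrable_real_indicator) (auto simp: less_top[symmetric])
  define a where "a = measure M A"
  define b where "b = measure M (B - A)"
  have Bm: "measure M B = a + b"
    using finite_measure_Diff[OF B A AB] unfolding a_def b_def by simp
  have split: "(\<integral>x. indicator B x * g x \<partial>M) = (\<integral>x. indicator A x * g x \<partial>M) + (\<integral>x. indicator (B - A) x * g x \<partial>M)"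
    using AB A B by (subst Bochner_Integration.integral_add[symmetric])
      (auto intro!: iA Bochner_Integration.integral_cong split: split_indicator)
  have mi: "(\<integral>x. indicator S x * m \<partial>M) = measure M S * m" if "S \<in> sets M" for S
    using that by (simp add: measure_restricted)
  have "a * m \<le> (\<integral>x. indicator A x * g x \<partial>M)"
    unfolding a_def mi[OF A, symmetric]
    using A by (intro integral_mono ind iA) (auto split: split_indicator intro: ge)
  hence 1: "b * (a * m) \<le> b * (\<integral>x. indicator A x * g x \<partial>M)"
    by (intro mult_left_mono) (auto simp: b_def)
  have "(\<integral>x. indicator (B - A) x * g x \<partial>M) \<le> b * m"
    unfolding b_def mi[OF sets.Diff[OF B A], symmetric]
    using A B by (intro integral_mono ind iA) (auto split: split_indicator intro: le)
  hence 2: "a * (\<integral>x. indicator (B - A) x * g x \<partial>M) \<le> a * (b * m)"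
    by (intro mult_left_mono) (auto simp: a_def)
  show ?thesis using 1 2 unfolding split Bm a_def[symmetric] by (simp add: algebra_simps)
qed

text \<open>Given \<open>X k = x\<close>, the other constraints have probability \<open>g x\<close>,
  which is nonincreasing in |x|. A set \<open>B\<close> containing the slab adds only points with
  |x| > s, so \<open>g s\<close> separates the values of \<open>g\<close> inside from those added.
  Allowing any such Borel set covers wider slabs and the whole line alike.\<close>

lemma slab_conditioning_mono:
  assumes P: "prob_space M" and X: "jointly_gaussian M (insert k I) X" and k: "k \<notin> I"
    and s: "0 \<le> s" and B[measurable]: "B \<in> sets borel" and sB: "{- s..s} \<subseteq> B"
  shows "measure M {\<omega>\<in>space M. \<bar>X k \<omega>\<bar> \<le> s} * measure M {\<omega>\<in>space M. X k \<omega> \<in> B \<and> (\<forall>i\<in>I. \<bar>X i \<omega>\<bar> \<le> r i)}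
    \<le> measure M {\<omega>\<in>space M. X k \<omega> \<in> B} * measure M {\<omega>\<in>space M. \<bar>X k \<omega>\<bar> \<le> s \<and> (\<forall>i\<in>I. \<bar>X i \<omega>\<bar> \<le> r i)}"
proof -
  interpret prob_space M by fact
  have fin: "finite I" using X by (simp add: jointly_gaussian_def)
  have Xm[measurable]: "X k \<in> borel_measurable M" "\<And>i. i \<in> I \<Longrightarrow> X i \<in> borel_measurable M"
    using X by (auto simp: jointly_gaussian_def)
  have "centered_gaussian_rv M (X k)" by (rule jointly_gaussian_single[OF X]) simp
  then consider "AE \<omega> in M. X k \<omega> = 0" | \<sigma> where "0 < \<sigma>" "distributed M lborel (X k) (normal_density 0 \<sigma>)"
    by (auto simp: centered_gaussian_rv_def)
  thus ?thesis
  proof cases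
    case 1
    \<comment> \<open>An almost surely zero \<open>X k\<close> satisfies both constraints, since 0
      lies in the slab and in \<open>B\<close>; the probabilities then agree in pairs.\<close>
    have 0: "0 \<in> B" using sB s by auto
    have "measure M {\<omega>\<in>space M. \<bar>X k \<omega>\<bar> \<le> s} = measure M {\<omega>\<in>space M. X k \<omega> \<in> B}"
      by (rule measure_eq_AE) (use 1 0 s in auto)
    moreover have "measure M {\<omega>\<in>space M. X k \<omega> \<in> B \<and> (\<forall>i\<in>I. \<bar>X i \<omega>\<bar> \<le> r i)}
       = measure M {\<omega>\<in>space M. \<bar>X k \<omega>\<bar> \<le> s \<and> (\<forall>i\<in>I. \<bar>X i \<omega>\<bar> \<le> r i)}"
      by (rule measure_eq_AE) (use 1 0 s fin in auto)
    ultimately show ?thesis by simp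
  next
    case 2
    note \<sigma> = 2(1)
    obtain c where c: "\<forall>B. (\<forall>i\<in>insert k I. B i \<in> sets borel) \<longrightarrow>
         measure M {\<omega>\<in>space M. \<forall>i\<in>insert k I. X i \<omega> \<in> B i} =
         (\<integral>s. normal_density 0 \<sigma> s * (indicator (B k) s *
            measure M {\<omega>\<in>space M. \<forall>i\<in>I. X i \<omega> - c i * X k \<omega> + c i * s \<in> B i}) \<partial>lborel)"
      using gaussian_disintegration[OF P X k 2] by (elim exE)
    define Y where "Y = (\<lambda>i \<omega>. X i \<omega> - c i * X k \<omega>)"
    have Y: "jointly_gaussian M I Y" unfolding Y_def by (rule jointly_gaussian_shear[OF X k])
    have Ym: "Y i \<in> borel_measurable M" if "i \<in> I" for i
      using Y that by (simp add: jointly_gaussian_def)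
    define g where "g = (\<lambda>s. box_prob M I Y r (\<lambda>i. s * c i))"
    have gm[measurable]: "g \<in> borel_measurable borel"
      using box_prob_line_measurable[OF fin Ym, where r = r and u = "\<lambda>_. 0" and c = c] unfolding g_def by simp
    define \<mu> where "\<mu> = density lborel (normal_density 0 \<sigma>)"
    interpret \<mu>: prob_space \<mu> unfolding \<mu>_def by (rule prob_space_normal_density[OF \<sigma>])
    have dk: "distr M lborel (X k) = \<mu>" unfolding \<mu>_def using 2(2) by (rule distributed_distr_eq_density)
    have [measurable_cong]: "sets \<mu> = sets borel" by (simp add: \<mu>_def)
    have marg: "measure M {\<omega>\<in>space M. X k \<omega> \<in> S} = measure \<mu> S" if "S \<in> sets borel" for S
      unfolding dk[symmetric] using that by (subst measure_distr) (auto intro!: arg_cong[where f="measure M"])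
    have rep: "measure M {\<omega>\<in>space M. X k \<omega> \<in> S \<and> (\<forall>i\<in>I. \<bar>X i \<omega>\<bar> \<le> r i)} = (\<integral>s. indicator S s * g s \<partial>\<mu>)"
      if S[measurable]: "S \<in> sets borel" for S
    proof -
      define D where "D = (\<lambda>i. if i = k then S else {x. \<bar>x\<bar> \<le> r i})"
      have "\<forall>i\<in>insert k I. D i \<in> sets borel" unfolding D_def by auto
      hence "measure M {\<omega>\<in>space M. \<forall>i\<in>insert k I. X i \<omega> \<in> D i} =
         (\<integral>s. normal_density 0 \<sigma> s * (indicator (D k) s *
            measure M {\<omega>\<in>space M. \<forall>i\<in>I. X i \<omega> - c i * X k \<omega> + c i * s \<in> D i}) \<partial>lborel)"
        using c by blast
      moreover have "X k \<omega> \<in> S \<and> (\<forall>i\<in>I. \<bar>X i \<omega>\<bar> \<le> r i) \<longleftrightarrow> (\<forall>i\<in>insert k I. X i \<omega> \<in> D i)" for \<omega>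
        using k unfolding D_def by auto
      moreover have "measure M {\<omega>\<in>space M. \<forall>i\<in>I. X i \<omega> - c i * X k \<omega> + c i * s \<in> D i} = g s" for s
      proof -
        have "(\<forall>i\<in>I. X i \<omega> - c i * X k \<omega> + c i * s \<in> D i) \<longleftrightarrow> (\<forall>i\<in>I. \<bar>Y i \<omega> + s * c i\<bar> \<le> r i)" for \<omega>
          using k unfolding D_def Y_def by (intro ball_cong) (auto simp: mult.commute)
        thus ?thesis unfolding g_def box_prob_def by simp
      qed
      moreover have "D k = S" by (simp add: D_def)
      moreover have "(\<integral>s. indicator S s * g s \<partial>\<mu>) = (\<integral>s. normal_density 0 \<sigma> s * (indicator S s * g s) \<partial>lborel)"
        unfolding \<mu>_def by (subst integral_density) auto
      ultimately show ?thesis by simp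
    qed
    have mono: "g b \<le> g a" if "\<bar>a\<bar> \<le> \<bar>b\<bar>" for a b
      unfolding g_def by (rule box_prob_shift_antimono[OF P Y that])
    have gi: "integrable \<mu> g"
      by (rule \<mu>.integrable_const_bound[where B=1]) (auto simp: g_def[THEN fun_cong] )
    have "measure \<mu> {- s..s} * (\<integral>x. indicator B x * g x \<partial>\<mu>) \<le> measure \<mu> B * (\<integral>x. indicator {- s..s} x * g x \<partial>\<mu>)"
      by (rule \<mu>.average_mono[where m = "g s"]) (use gi sB s in \<open>auto intro!: mono\<close>)
    moreover have "\<bar>x\<bar> \<le> s \<longleftrightarrow> x \<in> {- s..s}" for x by auto
    ultimately show ?thesis by (simp only: marg rep B borel_closed closed_atLeastAtMost sets_lborel)
  qed
qed

section \<open>Positive denominators and the comparison of ratios\<close>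

text \<open>Allows the cross-multiplied inequalities to be read as quotients. A normal density is
  positive everywhere, so a null event would force \<open>{- t..t}\<close> to be a Lebesgue null
  set.\<close>

lemma centered_gaussian_rv_small_ball_pos:
  assumes P: "prob_space M" and Y: "centered_gaussian_rv M Y" and t: "0 < t"
  shows "0 < measure M {\<omega>\<in>space M. \<bar>Y \<omega>\<bar> \<le> t}"
proof -
  interpret prob_space M by fact
  have [measurable]: "Y \<in> borel_measurable M" using Y by (simp add: centered_gaussian_rv_def)
  consider "AE \<omega> in M. Y \<omega> = 0" | \<sigma> where "0 < \<sigma>" "distributed M lborel Y (normal_density 0 \<sigma>)"
    using Y by (auto simp: centered_gaussian_rv_def)
  thus ?thesis
  proof cases
    case 1
    have "measure M {\<omega>\<in>space M. \<bar>Y \<omega>\<bar> \<le> t} = measure M (space M)"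
      by (rule measure_eq_AE) (use 1 t in auto)
    thus ?thesis by (simp add: prob_space)
  next
    case 2
    have eq: "Y -` {- t..t} \<inter> space M = {\<omega>\<in>space M. \<bar>Y \<omega>\<bar> \<le> t}" by auto
    have em: "emeasure M {\<omega>\<in>space M. \<bar>Y \<omega>\<bar> \<le> t} = (\<integral>\<^sup>+x. ennreal (normal_density 0 \<sigma> x) * indicator {- t..t} x \<partial>lborel)"
      using distributed_emeasure[OF 2(2), of "{- t..t}"] unfolding eq by simp
    show ?thesis
    proof (rule ccontr)
      assume "\<not> 0 < measure M {\<omega>\<in>space M. \<bar>Y \<omega>\<bar> \<le> t}"
      hence "emeasure M {\<omega>\<in>space M. \<bar>Y \<omega>\<bar> \<le> t} = 0"
        by (simp add: emeasure_eq_measure zero_less_measure_iff)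
      hence "AE x in lborel. ennreal (normal_density 0 \<sigma> x) * indicator {- t..t} x = 0"
        unfolding em by (subst (asm) nn_integral_0_iff_AE) auto
      hence "AE x in lborel. x \<notin> {- t..t}"
      proof (rule AE_mp, intro AE_I2 impI)
        fix x assume "ennreal (normal_density 0 \<sigma> x) * indicator {- t..t} x = 0"
        thus "x \<notin> {- t..t}" using normal_density_pos[OF 2(1), of 0 x] by (auto simp: indicator_def)
      qed
      moreover have "{x \<in> space lborel. \<not> x \<notin> {- t..t}} = {- t..t}" by auto
      ultimately have "emeasure lborel {- t..t} = 0" by (subst (asm) AE_iff_measurable) auto
      thus False using t by simp
    qed
  qed
qed

lemma ratio_monotone:
  assumes P: "prob_space M" and X: "jointly_gaussian M I X"
    and st: "\<And>i. i \<in> I \<Longrightarrow> 0 < s i" "\<And>i. i \<in> I \<Longrightarrow> s i \<le> t i"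
  shows "measure M {\<omega>\<in>space M. \<forall>i\<in>I. \<bar>X i \<omega>\<bar> \<le> t i} / (\<Prod>i\<in>I. measure M {\<omega>\<in>space M. \<bar>X i \<omega>\<bar> \<le> t i})
      \<le> measure M {\<omega>\<in>space M. \<forall>i\<in>I. \<bar>X i \<omega>\<bar> \<le> s i} / (\<Prod>i\<in>I. measure M {\<omega>\<in>space M. \<bar>X i \<omega>\<bar> \<le> s i})"
proof -
  define F where "F = (\<lambda>r. measure M {\<omega>\<in>space M. \<forall>i\<in>I. \<bar>X i \<omega>\<bar> \<le> r i})"
  define p where "p = (\<lambda>i x. measure M {\<omega>\<in>space M. \<bar>X i \<omega>\<bar> \<le> x})"
  have fin: "finite I" using X by (simp add: jointly_gaussian_def)
  have ps: "0 < p i (s i)" "0 < p i (t i)" if "i \<in> I" for i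
    using centered_gaussian_rv_small_ball_pos[OF P jointly_gaussian_single[OF X that]] st[OF that]
    unfolding p_def by auto
  \<comment> \<open>\<open>J\<close> holds the coordinates already lowered from \<open>t\<close> to
    \<open>s\<close>. The product form keeps the induction free of divisions.\<close>
  have step: "F t * (\<Prod>i\<in>J. p i (s i)) \<le> F (\<lambda>i. if i \<in> J then s i else t i) * (\<Prod>i\<in>J. p i (t i))"
    if "finite J" "J \<subseteq> I" for J
    using that
  proof (induction J rule: finite_induct)
    case empty
    show ?case by simp
  next
    case (insert k J)
    define r where "r = (\<lambda>i. if i \<in> J then s i else t i)"
    have k: "k \<in> I" "k \<notin> J" and J: "J \<subseteq> I" using insert by auto
    have I: "insert k (I - {k}) = I" using k by auto
    have all: "(\<forall>i\<in>I. Q i) \<longleftrightarrow> Q k \<and> (\<forall>i\<in>I - {k}. Q i)" for Q using k by blast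
    \<comment> \<open>Only coordinate \<open>k\<close> changes; the others enter with their current
      mixed thresholds \<open>r\<close>, so this inequality chains with the induction
      hypothesis.\<close>
    have "p k (s k) * measure M {\<omega>\<in>space M. X k \<omega> \<in> {- t k..t k} \<and> (\<forall>i\<in>I - {k}. \<bar>X i \<omega>\<bar> \<le> r i)}
       \<le> measure M {\<omega>\<in>space M. X k \<omega> \<in> {- t k..t k}} * measure M {\<omega>\<in>space M. \<bar>X k \<omega>\<bar> \<le> s k \<and> (\<forall>i\<in>I - {k}. \<bar>X i \<omega>\<bar> \<le> r i)}"
      unfolding p_def by (rule slab_conditioning_mono[OF P]) (use X I st[OF k(1)] in auto)
    also have "{\<omega>\<in>space M. X k \<omega> \<in> {- t k..t k} \<and> (\<forall>i\<in>I - {k}. \<bar>X i \<omega>\<bar> \<le> r i)} = {\<omega>\<in>space M. \<forall>i\<in>I. \<bar>X i \<omega>\<bar> \<le> r i}"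
      using k unfolding all by (auto simp: r_def)
    also have "{\<omega>\<in>space M. X k \<omega> \<in> {- t k..t k}} = {\<omega>\<in>space M. \<bar>X k \<omega>\<bar> \<le> t k}" by auto
    also have "{\<omega>\<in>space M. \<bar>X k \<omega>\<bar> \<le> s k \<and> (\<forall>i\<in>I - {k}. \<bar>X i \<omega>\<bar> \<le> r i)}
        = {\<omega>\<in>space M. \<forall>i\<in>I. \<bar>X i \<omega>\<bar> \<le> (if i \<in> insert k J then s i else t i)}"
      using k unfolding all by (auto simp: r_def)
    finally have *: "p k (s k) * F r \<le> p k (t k) * F (\<lambda>i. if i \<in> insert k J then s i else t i)"
      unfolding F_def p_def .
    have "F t * (\<Prod>i\<in>insert k J. p i (s i)) = p k (s k) * (F t * (\<Prod>i\<in>J. p i (s i)))"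
      using insert.hyps by simp
    also have "\<dots> \<le> p k (s k) * (F r * (\<Prod>i\<in>J. p i (t i)))"
      unfolding r_def using insert.IH[OF J] by (intro mult_left_mono) (auto simp: p_def)
    also have "\<dots> = (p k (s k) * F r) * (\<Prod>i\<in>J. p i (t i))" by simp
    also have "\<dots> \<le> (p k (t k) * F (\<lambda>i. if i \<in> insert k J then s i else t i)) * (\<Prod>i\<in>J. p i (t i))"
      by (intro mult_right_mono * prod_nonneg) (auto simp: p_def)
    also have "\<dots> = F (\<lambda>i. if i \<in> insert k J then s i else t i) * (\<Prod>i\<in>insert k J. p i (t i))"
      using insert.hyps by simp
    finally show ?case .
  qed
  have "F (\<lambda>i. if i \<in> I then s i else t i) = F s" unfolding F_def by (simp cong: ball_cong)
  hence "F t * (\<Prod>i\<in>I. p i (s i)) \<le> F s * (\<Prod>i\<in>I. p i (t i))" using step[OF fin] by simp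
  moreover have "0 < (\<Prod>i\<in>I. p i (s i))" "0 < (\<Prod>i\<in>I. p i (t i))" by (auto intro!: prod_pos ps)
  ultimately have "F t / (\<Prod>i\<in>I. p i (t i)) \<le> F s / (\<Prod>i\<in>I. p i (s i))" by (simp add: field_simps)
  thus ?thesis unfolding F_def p_def .
qed

theorem theorem1p1:
  fixes M :: "'a measure" and n :: nat and X :: "nat \<Rightarrow> 'a \<Rightarrow> real"
  assumes "prob_space M"
    and "n \<ge> 1"
    and "centered_jointly_gaussian M n X"
  shows "(\<forall>a1 :: ereal. a1 > 0 \<longrightarrow>
           measure M {\<omega>\<in>space M. ereal \<bar>X 1 \<omega>\<bar> \<le> 1 + a1}
             * measure M {\<omega>\<in>space M. \<forall>i\<in>{1..n}. \<bar>X i \<omega>\<bar> \<le> 1}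
           \<ge> measure M {\<omega>\<in>space M. \<bar>X 1 \<omega>\<bar> \<le> 1}
             * measure M {\<omega>\<in>space M. ereal \<bar>X 1 \<omega>\<bar> \<le> 1 + a1
                                     \<and> (\<forall>i\<in>{2..n}. \<bar>X i \<omega>\<bar> \<le> 1)})
     \<and> (\<forall>a :: nat \<Rightarrow> real. (\<forall>i\<in>{1..n}. a i > 0) \<longrightarrow>
           measure M {\<omega>\<in>space M. \<forall>i\<in>{1..n}. \<bar>X i \<omega>\<bar> \<le> 1 + a i}
             / (\<Prod>i\<in>{1..n}. measure M {\<omega>\<in>space M. \<bar>X i \<omega>\<bar> \<le> 1 + a i})
           \<le> measure M {\<omega>\<in>space M. \<forall>i\<in>{1..n}. \<bar>X i \<omega>\<bar> \<le> 1}
             / (\<Prod>i\<in>{1..n}. measure M {\<omega>\<in>space M. \<bar>X i \<omega>\<bar> \<le> 1}))"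
proof (intro conjI allI impI)
  have X: "jointly_gaussian M {1..n} X"
    using assms(3) by (simp add: centered_jointly_gaussian_def jointly_gaussian_def)
  have n: "{1..n} = insert 1 {2..n}" using \<open>n \<ge> 1\<close> by auto
  have split: "(\<forall>i\<in>{1..n}. Q i) \<longleftrightarrow> Q 1 \<and> (\<forall>i\<in>{2..n}. Q i)" for Q unfolding n by blast
  {
    fix a1 :: ereal assume a: "a1 > 0"
    \<comment> \<open>As a Borel set the extended threshold needs no distinction between finite and
      infinite \<open>a1\<close>; for \<infinity> it is the whole line.\<close>
    define B where "B = {x :: real. ereal \<bar>x\<bar> \<le> 1 + a1}"
    have "ereal \<bar>x\<bar> \<le> 1 + a1" if "x \<in> {- 1..1}" for x
    proof -
      have "ereal \<bar>x\<bar> \<le> ereal 1" using that by (subst ereal_less_eq) (auto simp: abs_le_iff)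
      also have "\<dots> \<le> 1 + a1" using a by (simp add: one_ereal_def[symmetric] add_increasing2)
      finally show ?thesis .
    qed
    hence B1: "{- 1..1} \<subseteq> B" unfolding B_def by blast
    have B: "B \<in> sets borel" unfolding B_def by measurable
    have "jointly_gaussian M (insert 1 {2..n}) X" using X unfolding n .
    from slab_conditioning_mono[OF assms(1) this _ _ B B1, where r = "\<lambda>_. 1"]
    have "measure M {\<omega>\<in>space M. \<bar>X 1 \<omega>\<bar> \<le> 1} * measure M {\<omega>\<in>space M. X 1 \<omega> \<in> B \<and> (\<forall>i\<in>{2..n}. \<bar>X i \<omega>\<bar> \<le> 1)}
      \<le> measure M {\<omega>\<in>space M. X 1 \<omega> \<in> B} * measure M {\<omega>\<in>space M. \<bar>X 1 \<omega>\<bar> \<le> 1 \<and> (\<forall>i\<in>{2..n}. \<bar>X i \<omega>\<bar> \<le> 1)}"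
      by simp
    thus "measure M {\<omega>\<in>space M. ereal \<bar>X 1 \<omega>\<bar> \<le> 1 + a1}
             * measure M {\<omega>\<in>space M. \<forall>i\<in>{1..n}. \<bar>X i \<omega>\<bar> \<le> 1}
           \<ge> measure M {\<omega>\<in>space M. \<bar>X 1 \<omega>\<bar> \<le> 1}
             * measure M {\<omega>\<in>space M. ereal \<bar>X 1 \<omega>\<bar> \<le> 1 + a1
                                     \<and> (\<forall>i\<in>{2..n}. \<bar>X i \<omega>\<bar> \<le> 1)}"
      unfolding split B_def mem_Collect_eq .
  }
  \<comment> \<open>The bound on the supremum is expressed as a bound for every admissible
    \<open>a\<close>.\<close>
  fix a :: "nat \<Rightarrow> real" assume a: "\<forall>i\<in>{1..n}. a i > 0"
  show "measure M {\<omega>\<in>space M. \<forall>i\<in>{1..n}. \<bar>X i \<omega>\<bar> \<le> 1 + a i}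
             / (\<Prod>i\<in>{1..n}. measure M {\<omega>\<in>space M. \<bar>X i \<omega>\<bar> \<le> 1 + a i})
           \<le> measure M {\<omega>\<in>space M. \<forall>i\<in>{1..n}. \<bar>X i \<omega>\<bar> \<le> 1}
             / (\<Prod>i\<in>{1..n}. measure M {\<omega>\<in>space M. \<bar>X i \<omega>\<bar> \<le> 1})"
    by (rule ratio_monotone[OF assms(1) X]) (use a in \<open>auto simp: less_imp_le\<close>)
qed

end
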